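(* Let $m\ge3$ be an odd integer and $n=2m$. Let $f:[0,\infty)\to[0,\infty)$ be continuous with $f(t)=O(t^\sigma)$ as $t\to\infty$ for some $\sigma>0$. Let $v$ be a $C^{2m}$ nonnegative solution of $$0\le-\Delta^m v\le f(v)\quad\text{in }\mathbb{R}^n\setminus B_{1/2}(0).$$ Then $v(y)=o(|y|^{n-2}\log(5|y|))$ as $|y|\to\infty$.
   Context: $\Delta^m$ is the $m$-fold iterated Laplacian; $B_{1/2}(0)$ is the open ball of radius $1/2$ about the origin. *)

theory Defs
  imports "HOL-Analysis.Analysis" "HOL-Library.Landau_Symbols"
begin

definition partial_deriv :: "'n::finite \<Rightarrow> (real^'n \<Rightarrow> real) \<Rightarrow> real^'n \<Rightarrow> real" where
  "partial_deriv i g x = deriv (\<lambda>t. g (x + t *\<^sub>R axis i 1)) 0"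

definition laplacian :: "(real^'n::finite \<Rightarrow> real) \<Rightarrow> real^'n \<Rightarrow> real" where
  "laplacian g x = (\<Sum>i\<in>UNIV. partial_deriv i (partial_deriv i g) x)"

definition iter_laplacian :: "nat \<Rightarrow> (real^'n::finite \<Rightarrow> real) \<Rightarrow> real^'n \<Rightarrow> real" where
  "iter_laplacian m g = (laplacian ^^ m) g"

fun Ck_on :: "nat \<Rightarrow> (real^'n::finite) set \<Rightarrow> (real^'n \<Rightarrow> real) \<Rightarrow> bool" where
  "Ck_on 0 S g = continuous_on S g"
| "Ck_on (Suc k) S g = (continuous_on S g \<and>
     (\<forall>i. \<forall>x\<in>S. (\<lambda>t. g (x + t *\<^sub>R axis i 1)) differentiable (at 0)) \<and>
     (\<forall>i. Ck_on k S (partial_deriv i g)))"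

end

theory Submission
  imports Defs
begin

text \<open>Only the behaviour at infinity matters, so \<open>v\<close> is replaced by a smooth nonnegative \<open>V\<close> on the whole
  space that vanishes near the origin; put \<open>g = - \<Delta> ^ m V\<close>. All estimates come from pairing
  \<open>\<Delta> ^ m\<close> with explicit radial test functions.

  A truncated fundamental solution on the scale \<open>R\<close> gives at once that the integral of \<open>V\<close> over the
  ball of radius \<open>R\<close> is \<open>O(R ^ (4 * m - 2))\<close> and that \<open>g / |y| ^ (2 * m - 2)\<close> is integrable at infinity.
  Truncating \<open>- ln (|y - y1|\<^sup>2 + \<epsilon>)\<close> gives a local bound of \<open>V y1\<close> by the mean of \<open>V\<close> over
  a ball around \<open>y1\<close> plus the logarithmic potential of \<open>g\<close> there.

  If \<open>V y0 > \<delta> * |y0| ^ (2 * m - 2) * ln (5 * |y0|)\<close> with \<open>|y0|\<close> large, one moves to a point \<open>y1\<close> near which \<open>V\<close>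
  is at most a multiple of \<open>V y1\<close>, hence \<open>g\<close> at most a multiple of \<open>(1 + V y1) powr \<sigma>\<close>. Splitting
  the potential at the radius where this bound becomes harmless costs a factor
  \<open>ln |y0| + ln (1 + V y1)\<close> on the mass of \<open>g\<close>, which is \<open>o(|y0| ^ (2 * m - 2))\<close>. This
  contradicts the size of \<open>V y1\<close>.\<close>

section \<open>Integration by parts\<close>

text \<open>Oddness of \<open>m\<close> enters through the logarithm: \<open>- \<Delta> ^ m\<close>
  is then \<open>(- \<Delta>) ^ m\<close>, for which a positive multiple of \<open>- ln |y|\<close>
  is a fundamental solution in dimension \<open>2 * m\<close>. The obstacle is that \<sigma> is
  arbitrary, so \<open>g \<le> f V\<close> bounds \<open>g\<close> only once \<open>V\<close> is
  bounded, and this is why a point with a local bound on \<open>V\<close> has to be found. A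
  logarithmic kernel forgives large powers: a density of height
  \<open>(1 + V y1) powr \<sigma>\<close> contributes O(1) from a ball of radius
  \<open>(1 + V y1) powr (- \<sigma> / (2 * m))\<close>, and the logarithm of that radius is
  absorbed by the linear \<open>V y1\<close> on the other side. The little o, rather than O, comes
  from the tail of a convergent integral standing in front of the logarithm. Test functions are
  regularised and compactly supported, so that integration by parts replaces any representation
  formula with a singular kernel, and finite smoothness suffices.\<close>

lemma Ck_on_imp_continuous_on: "Ck_on k S g \<Longrightarrow> continuous_on S g"
  by (cases k) auto

lemma Ck_on_SucD: "Ck_on (Suc k) S g \<Longrightarrow> Ck_on k S g"
proof (induction k arbitrary: g)
  case (Suc k)
  have "Ck_on k S (partial_deriv i g)" for i
    using Suc.prems by (intro Suc.IH) simp
  with Suc.prems show ?case by simp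
qed simp

lemma Ck_on_mono: "Ck_on k S g \<Longrightarrow> l \<le> k \<Longrightarrow> Ck_on l S g"
  by (induction k) (auto simp: le_Suc_eq dest: Ck_on_SucD simp del: Ck_on.simps(2))

lemma Ck_on_subset: "Ck_on k S g \<Longrightarrow> T \<subseteq> S \<Longrightarrow> Ck_on k T g"
  by (induction k arbitrary: g) (auto intro: continuous_on_subset)

lemma Ck_on_Un: "open S \<Longrightarrow> open T \<Longrightarrow> Ck_on k S g \<Longrightarrow> Ck_on k T g \<Longrightarrow> Ck_on k (S \<union> T) g"
  by (induction k arbitrary: g) (auto intro: continuous_on_open_Un)

lemma eventually_line_in_open:
  fixes x :: "real^'n::finite"
  assumes "open S" "x \<in> S"
  shows "eventually (\<lambda>t. x + t *\<^sub>R v \<in> S) (nhds (0::real))"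
proof -
  have "isCont (\<lambda>t. x + t *\<^sub>R v) (0::real)" by (intro continuous_intros)
  then have "((\<lambda>t. x + t *\<^sub>R v) \<longlongrightarrow> x) (nhds (0::real))"
    by (simp add: isCont_def tendsto_nhds_iff)
  then show ?thesis using assms by (simp add: topological_tendstoD)
qed

lemma partial_deriv_cong:
  assumes "open S" "x \<in> S" "\<And>y. y \<in> S \<Longrightarrow> f y = g y"
  shows "partial_deriv i f x = partial_deriv i g x"
  unfolding partial_deriv_def
  using eventually_line_in_open[OF assms(1,2), of "axis i 1"]
  by (intro deriv_cong_ev) (auto elim!: eventually_mono intro: assms(3))

lemma Ck_on_cong:
  assumes "open S" "\<And>y. y \<in> S \<Longrightarrow> f y = g y"
  shows "Ck_on k S f \<Longrightarrow> Ck_on k S g"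
  using assms(2)
proof (induction k arbitrary: f g)
  case 0
  then show ?case by (simp cong: continuous_on_cong)
next
  case (Suc k)
  have "(\<lambda>t. g (x + t *\<^sub>R axis i 1)) differentiable at 0" if x: "x \<in> S" for x i
  proof -
    have "(\<lambda>t. f (x + t *\<^sub>R axis i 1)) differentiable at 0" using Suc.prems(1) x by simp
    then obtain D where "((\<lambda>t. f (x + t *\<^sub>R axis i 1)) has_real_derivative D) (at 0)"
      by (auto simp: real_differentiable_def)
    then have "((\<lambda>t. g (x + t *\<^sub>R axis i 1)) has_real_derivative D) (at 0)"
      using eventually_line_in_open[OF assms(1) x, of "axis i 1"] 
      by (subst DERIV_cong_ev[OF refl _ refl, where g="\<lambda>t. f (x + t *\<^sub>R axis i 1)"])
         (auto elim!: eventually_mono simp: Suc.prems(2))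
    then show ?thesis by (auto simp: real_differentiable_def)
  qed
  moreover have "Ck_on k S (partial_deriv i g)" for i
  proof (rule Suc.IH)
    show "Ck_on k S (partial_deriv i f)" using Suc.prems(1) by simp
    show "partial_deriv i f y = partial_deriv i g y" if "y \<in> S" for y
      by (rule partial_deriv_cong[OF assms(1) that Suc.prems(2)])
  qed
  moreover have "continuous_on S g"
    using Suc.prems by (simp cong: continuous_on_cong)
  ultimately show ?case by simp
qed

text \<open>Replaces \<open>partial_deriv\<close>, a value selected by \<open>deriv\<close>, by an
  explicit formula for the derivative. The closure rules for constants, coordinates, sums and
  products go through this form.\<close>

lemma Ck_on_SucI:
  assumes "open S" "continuous_on S g"
    and "\<And>i x. x \<in> S \<Longrightarrow> ((\<lambda>t. g (x + t *\<^sub>R axis i 1)) has_real_derivative g' i x) (at 0)"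
    and "\<And>i. Ck_on k S (g' i)"
  shows "Ck_on (Suc k) S g"
proof -
  have "partial_deriv i g x = g' i x" if "x \<in> S" for i x
    unfolding partial_deriv_def by (rule DERIV_imp_deriv[OF assms(3)[OF that]])
  then have "Ck_on k S (partial_deriv i g)" for i
    by (intro Ck_on_cong[OF assms(1) _ assms(4)]) auto
  with assms(2,3) show ?thesis by (auto simp: real_differentiable_def)
qed

lemma Ck_on_DERIV0:
  assumes "Ck_on (Suc k) S g" "x \<in> S"
  shows "((\<lambda>t. g (x + t *\<^sub>R axis i 1)) has_real_derivative partial_deriv i g x) (at 0)"
  using assms unfolding partial_deriv_def
  by (simp add: DERIV_deriv_iff_real_differentiable)

lemma Ck_on_DERIV:
  assumes "Ck_on (Suc k) S g" "x + t *\<^sub>R axis i 1 \<in> S"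
  shows "((\<lambda>s. g (x + s *\<^sub>R axis i 1)) has_real_derivative partial_deriv i g (x + t *\<^sub>R axis i 1)) (at t)"
  using Ck_on_DERIV0[OF assms, of i] DERIV_shift[of "\<lambda>s. g (x + s *\<^sub>R axis i 1)" _ 0 t]
  by (simp add: algebra_simps)

lemma partial_deriv_eqI:
  "((\<lambda>t. g (x + t *\<^sub>R axis i 1)) has_real_derivative D) (at 0) \<Longrightarrow> partial_deriv i g x = D"
  unfolding partial_deriv_def by (rule DERIV_imp_deriv)

lemma Ck_on_const: "open S \<Longrightarrow> Ck_on k S (\<lambda>_. c)"
proof (induction k arbitrary: c)
  case (Suc k)
  show ?case by (rule Ck_on_SucI[where g'="\<lambda>_ _. 0"]) (use Suc in \<open>auto intro!: derivative_eq_intros\<close>)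
qed simp

lemma Ck_on_coord: "open S \<Longrightarrow> Ck_on k S (\<lambda>x. x $ j)"
proof (cases k)
  case (Suc l)
  assume "open S"
  then show ?thesis unfolding Suc
    by (intro Ck_on_SucI[where g'="\<lambda>i _. axis i 1 $ j"] Ck_on_const)
       (auto intro!: derivative_eq_intros continuous_intros)
qed (auto intro!: continuous_intros)

lemma Ck_on_add:
  assumes "open S" shows "Ck_on k S f \<Longrightarrow> Ck_on k S g \<Longrightarrow> Ck_on k S (\<lambda>x. f x + g x)"
proof (induction k arbitrary: f g)
  case (Suc k)
  show ?case
    by (rule Ck_on_SucI[OF assms, where g'="\<lambda>i x. partial_deriv i f x + partial_deriv i g x"])
       (use Suc.prems in \<open>auto intro!: Suc.IH continuous_intros DERIV_add Ck_on_DERIV0 simp del: Ck_on.simps(2)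
          dest: Ck_on_imp_continuous_on\<close>, use Suc.prems in auto)
qed (auto intro: continuous_intros)

lemma Ck_on_mult:
  assumes "open S" shows "Ck_on k S f \<Longrightarrow> Ck_on k S g \<Longrightarrow> Ck_on k S (\<lambda>x. f x * g x)"
proof (induction k arbitrary: f g)
  case (Suc k)
  have c: "continuous_on S f" "continuous_on S g" using Suc.prems by auto
  have "Ck_on k S (\<lambda>x. partial_deriv i f x * g x + f x * partial_deriv i g x)" for i
    using Suc.prems by (intro Ck_on_add[OF assms] Suc.IH) (auto dest: Ck_on_SucD simp del: Ck_on.simps(2), auto)
  moreover have "((\<lambda>t. f (x + t *\<^sub>R axis i 1) * g (x + t *\<^sub>R axis i 1)) has_real_derivative
      partial_deriv i f x * g x + f x * partial_deriv i g x) (at 0)" if "x \<in> S" for i x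
    using DERIV_mult[OF Ck_on_DERIV0[OF Suc.prems(1) that] Ck_on_DERIV0[OF Suc.prems(2) that], of i i]
    by (simp add: algebra_simps)
  ultimately show ?case
    by (intro Ck_on_SucI[OF assms, where g'="\<lambda>i x. partial_deriv i f x * g x + f x * partial_deriv i g x"])
       (auto intro!: continuous_intros c)
qed (auto intro: continuous_intros)

lemma Ck_on_sum:
  assumes "open S" "\<And>i. i \<in> I \<Longrightarrow> Ck_on k S (f i)"
  shows "Ck_on k S (\<lambda>x. \<Sum>i\<in>I. f i x)"
  using assms(2)
  by (induction I rule: infinite_finite_induct) (auto intro!: Ck_on_const Ck_on_add assms(1))

section \<open>Iterated Laplacians: regularity and locality\<close>

lemma Ck_on_laplacian:
  assumes "open S" "Ck_on (Suc (Suc k)) S g"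
  shows "Ck_on k S (laplacian g)"
  using Ck_on_sum[OF assms(1), of UNIV k "\<lambda>i. partial_deriv i (partial_deriv i g)"] assms(2)
  unfolding laplacian_def[abs_def] by simp

lemma iter_laplacian_0 [simp]: "iter_laplacian 0 g = g"
  by (simp add: iter_laplacian_def)

lemma iter_laplacian_Suc: "iter_laplacian (Suc k) g = laplacian (iter_laplacian k g)"
  by (simp add: iter_laplacian_def)

lemma iter_laplacian_Suc': "iter_laplacian (Suc k) g = iter_laplacian k (laplacian g)"
  by (simp add: iter_laplacian_def funpow_Suc_right del: funpow.simps)

lemma Ck_on_iter_laplacian:
  "open S \<Longrightarrow> Ck_on (l + 2 * k) S g \<Longrightarrow> Ck_on l S (iter_laplacian k g)"
  by (induction k arbitrary: l) (auto simp: iter_laplacian_Suc intro!: Ck_on_laplacian simp del: Ck_on.simps(2))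

lemma laplacian_cong:
  assumes "open S" "x \<in> S" "\<And>y. y \<in> S \<Longrightarrow> f y = g y"
  shows "laplacian f x = laplacian g x"
  unfolding laplacian_def
  by (intro sum.cong refl partial_deriv_cong[OF assms(1,2)] partial_deriv_cong[OF assms(1)] assms(3))

lemma iter_laplacian_cong:
  assumes "open S" "x \<in> S" "\<And>y. y \<in> S \<Longrightarrow> f y = g y"
  shows "iter_laplacian k f x = iter_laplacian k g x"
  using assms(2)
proof (induction k arbitrary: x)
  case (Suc k)
  show ?case unfolding iter_laplacian_Suc by (rule laplacian_cong[OF assms(1) Suc.prems Suc.IH])
qed (simp add: assms(3))

lemma partial_deriv_const [simp]: "partial_deriv i (\<lambda>_. c) = (\<lambda>_. 0)"
  by (intro ext partial_deriv_eqI) (auto intro!: derivative_eq_intros)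

lemma iter_laplacian_zero [simp]: "iter_laplacian k (\<lambda>_. 0) = (\<lambda>_. 0)"
  by (induction k) (simp_all add: iter_laplacian_Suc laplacian_def[abs_def])

lemma vanishing_outside_iter_laplacian:
  assumes "\<And>x. norm x > R \<Longrightarrow> w x = 0" "norm x > R"
  shows "iter_laplacian k w x = 0"
proof -
  have "open {x::real^'n::finite. norm x > R}" by (intro open_Collect_less continuous_intros)
  then have "iter_laplacian k w x = iter_laplacian k (\<lambda>_. 0) x"
    by (rule iter_laplacian_cong) (use assms in auto)
  then show ?thesis by simp
qed

lemma vanishing_outside_partial_deriv:
  assumes "\<And>x. norm x > R \<Longrightarrow> w x = 0" "norm x > R"
  shows "partial_deriv i w x = 0"
proof -
  have "open {x::real^'n::finite. norm x > R}" by (intro open_Collect_less continuous_intros)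
  then have "partial_deriv i w x = partial_deriv i (\<lambda>_. 0) x"
    by (rule partial_deriv_cong) (use assms in auto)
  then show ?thesis by simp
qed

section \<open>Green's identity for compactly supported test functions\<close>

lemma integrable_compact_support:
  fixes w :: "real^'n::finite \<Rightarrow> real"
  assumes "continuous_on UNIV w" "\<And>x. norm x > R \<Longrightarrow> w x = 0"
  shows "integrable lborel w"
proof -
  have "integrable lborel (\<lambda>x. indicator (cball 0 R) x *\<^sub>R w x)"
    by (intro borel_integrable_compact continuous_on_subset[OF assms(1)]) auto
  moreover have "(\<lambda>x. indicator (cball 0 R) x *\<^sub>R w x) = w"
    using assms(2) by (auto simp: fun_eq_iff indicator_def)
  ultimately show ?thesis by simp
qed

lemma integral_translate:
  fixes w :: "real^'n::finite \<Rightarrow> real"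
  assumes "w \<in> borel_measurable borel"
  shows "integral\<^sup>L lborel (\<lambda>x. w (x + a)) = integral\<^sup>L lborel w"
  using integral_distr[of "(+) a" lborel borel w] assms
  by (simp add: lborel_distr_plus add.commute)

text \<open>Translation invariance of Lebesgue measure makes the integral of every difference
  quotient zero, and dominated convergence passes to the derivative.\<close>

lemma integral_partial_deriv:
  fixes w :: "real^'n::finite \<Rightarrow> real"
  assumes "Ck_on (Suc 0) UNIV w" "\<And>x. norm x > R \<Longrightarrow> w x = 0"
  shows "integral\<^sup>L lborel (partial_deriv i w) = 0"
proof -
  define e where "e = (axis i 1 :: real^'n)"
  have e: "norm e = 1" by (simp add: e_def)
  have cw: "continuous_on UNIV w" and cd: "continuous_on UNIV (partial_deriv i w)"
    using assms(1) by auto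
  have bm: "w \<in> borel_measurable borel" using cw by (rule borel_measurable_continuous_onI)
  have iw: "integrable lborel w" by (rule integrable_compact_support[OF cw assms(2)])
  have d0: "partial_deriv i w x = 0" if "norm x > R" for x
    using assms(2) that by (rule vanishing_outside_partial_deriv)
  have "compact (partial_deriv i w ` cball 0 R)"
    by (intro compact_continuous_image continuous_on_subset[OF cd]) auto
  then obtain B0 where "\<forall>y\<in>partial_deriv i w ` cball 0 R. norm y \<le> B0"
    by (blast dest: compact_imp_bounded[THEN bounded_iff[THEN iffD1]])
  then have B0: "\<bar>partial_deriv i w x\<bar> \<le> B0" if "x \<in> cball 0 R" for x using that by simp
  define B where "B = max B0 0"
  have B: "\<bar>partial_deriv i w x\<bar> \<le> B" for x
    using B0[of x] d0[of x] by (cases "norm x \<le> R") (auto simp: B_def)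
  define s where "s k x = real (Suc k) * (w (x + (1 / real (Suc k)) *\<^sub>R e) - w x)" for k x
  have s0: "integral\<^sup>L lborel (s k) = 0" for k
  proof -
    have "integrable lborel (\<lambda>x. w (x + (1 / real (Suc k)) *\<^sub>R e))"
      using integrable_distr[of "(+) ((1 / real (Suc k)) *\<^sub>R e)" lborel borel w] iw
      by (simp add: lborel_distr_plus add.commute)
    then show ?thesis unfolding s_def
      using integral_translate[OF bm, of "(1 / real (Suc k)) *\<^sub>R e"] iw by simp
  qed
  have line: "((\<lambda>s. w (x + s *\<^sub>R e)) has_real_derivative partial_deriv i w (x + t *\<^sub>R e)) (at t)" for x t
    unfolding e_def by (rule Ck_on_DERIV[OF assms(1)]) simp
  \<comment> \<open>By the mean value theorem each quotient is a value of the derivative. The radius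
    is \<open>R + 1\<close> because the step \<open>1 / Suc k\<close> is at most 1.\<close>
  have bound: "norm (s k x) \<le> indicator (cball 0 (R + 1)) x * B" for k x
  proof (cases "norm x \<le> R + 1")
    case True
    define h where "h = 1 / real (Suc k)"
    have h: "h > 0" by (simp add: h_def)
    obtain z where "w (x + h *\<^sub>R e) - w (x + 0 *\<^sub>R e) = (h - 0) * partial_deriv i w (x + z *\<^sub>R e)"
      using MVT2[OF h, of "\<lambda>s. w (x + s *\<^sub>R e)" "\<lambda>t. partial_deriv i w (x + t *\<^sub>R e)"] line by blast
    then have "s k x = partial_deriv i w (x + z *\<^sub>R e)"
      by (simp add: s_def h_def)
    then show ?thesis using B True by simp
  next
    case False
    have "norm x \<le> norm (x + (1 / real (Suc k)) *\<^sub>R e) + norm ((1 / real (Suc k)) *\<^sub>R e)"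
      using norm_triangle_ineq4[of "x + (1 / real (Suc k)) *\<^sub>R e" "(1 / real (Suc k)) *\<^sub>R e"] by simp
    moreover have "norm ((1 / real (Suc k)) *\<^sub>R e) \<le> 1" using e by simp
    ultimately have "norm (x + (1 / real (Suc k)) *\<^sub>R e) > R" using False by linarith
    then show ?thesis using False assms(2) by (simp add: s_def)
  qed
  have "(\<lambda>k. integral\<^sup>L lborel (s k)) \<longlonglongrightarrow> integral\<^sup>L lborel (partial_deriv i w)"
  proof (rule integral_dominated_convergence[where w="\<lambda>x. indicator (cball 0 (R + 1)) x * B"])
    show "partial_deriv i w \<in> borel_measurable lborel"
      using borel_measurable_continuous_onI[OF cd] by simp
    show "s k \<in> borel_measurable lborel" for k
      unfolding s_def using bm by (intro borel_measurable_times borel_measurable_diff) auto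
    show "integrable lborel (\<lambda>x. indicator (cball 0 (R + 1)) x * B :: real)"
      by (auto intro!: emeasure_compact_finite)
    show "AE x in lborel. (\<lambda>k. s k x) \<longlonglongrightarrow> partial_deriv i w x"
    proof (rule AE_I2)
      fix x
      have "((\<lambda>h. (w (x + h *\<^sub>R e) - w x) / h) \<longlongrightarrow> partial_deriv i w x) (at 0)"
        using line[of x 0] by (simp add: DERIV_def)
      moreover have "filterlim (\<lambda>k. 1 / real (Suc k)) (at 0) sequentially"
        unfolding filterlim_at using LIMSEQ_inverse_real_of_nat by (auto simp: divide_simps)
      ultimately have "(\<lambda>k. (w (x + (1 / real (Suc k)) *\<^sub>R e) - w x) / (1 / real (Suc k))) \<longlonglongrightarrow> partial_deriv i w x"
        by (rule filterlim_compose)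
      then show "(\<lambda>k. s k x) \<longlonglongrightarrow> partial_deriv i w x" by (simp add: s_def mult.commute)
    qed
    show "AE x in lborel. norm (s k x) \<le> indicator (cball 0 (R + 1)) x * B" for k
      using bound by simp
  qed
  then have "(\<lambda>_::nat. 0) \<longlonglongrightarrow> integral\<^sup>L lborel (partial_deriv i w)" by (simp add: s0)
  then show ?thesis by (simp add: LIMSEQ_const_iff)
qed

lemma integral_by_parts:
  fixes u w :: "real^'n::finite \<Rightarrow> real"
  assumes u: "Ck_on (Suc 0) UNIV u" and w: "Ck_on (Suc 0) UNIV w" and "\<And>x. norm x > R \<Longrightarrow> w x = 0"
  shows "(\<integral>x. u x * partial_deriv i w x \<partial>lborel) = - (\<integral>x. partial_deriv i u x * w x \<partial>lborel)"
proof -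
  have c: "continuous_on UNIV u" "continuous_on UNIV w"
    "continuous_on UNIV (partial_deriv i u)" "continuous_on UNIV (partial_deriv i w)" using u w by auto
  have w0: "partial_deriv i w x = 0" if "norm x > R" for x
    using assms(3) that by (rule vanishing_outside_partial_deriv)
  have "partial_deriv i (\<lambda>x. u x * w x) = (\<lambda>x. u x * partial_deriv i w x + partial_deriv i u x * w x)"
  proof (intro ext partial_deriv_eqI)
    fix x
    show "((\<lambda>t. u (x + t *\<^sub>R axis i 1) * w (x + t *\<^sub>R axis i 1)) has_real_derivative
        u x * partial_deriv i w x + partial_deriv i u x * w x) (at 0)"
      using DERIV_mult[OF Ck_on_DERIV0[OF u UNIV_I, of x i] Ck_on_DERIV0[OF w UNIV_I, of x i]]
      by (simp add: algebra_simps)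
  qed
  moreover have "integral\<^sup>L lborel (partial_deriv i (\<lambda>x. u x * w x)) = 0"
    by (rule integral_partial_deriv[where R=R]) (use Ck_on_mult[OF open_UNIV u w] assms(3) in auto)
  moreover have "integrable lborel (\<lambda>x. u x * partial_deriv i w x)"
    by (rule integrable_compact_support[where R=R]) (auto intro!: continuous_intros c simp: w0)
  moreover have "integrable lborel (\<lambda>x. partial_deriv i u x * w x)"
    by (rule integrable_compact_support[where R=R]) (auto intro!: continuous_intros c simp: assms(3))
  ultimately show ?thesis by simp
qed

lemma integral_laplacian_swap:
  fixes u w :: "real^'n::finite \<Rightarrow> real"
  assumes u: "Ck_on 2 UNIV u" and w: "Ck_on 2 UNIV w" and w0: "\<And>x. norm x > R \<Longrightarrow> w x = 0"
  shows "(\<integral>x. u x * laplacian w x \<partial>lborel) = (\<integral>x. laplacian u x * w x \<partial>lborel)"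
proof -
  have u': "Ck_on (Suc 0) UNIV u" "\<And>i. Ck_on (Suc 0) UNIV (partial_deriv i u)"
    and w': "Ck_on (Suc 0) UNIV w" "\<And>i. Ck_on (Suc 0) UNIV (partial_deriv i w)"
    using u w Ck_on_mono[of 2 UNIV _ "Suc 0"] unfolding numeral_2_eq_2 by auto
  have pw0: "norm x > R \<Longrightarrow> partial_deriv i w x = 0" for i x
    using w0 by (rule vanishing_outside_partial_deriv)
  have ppw0: "norm x > R \<Longrightarrow> partial_deriv j (partial_deriv i w) x = 0" for i j x
    using pw0 by (rule vanishing_outside_partial_deriv)
  have c: "continuous_on UNIV u" "continuous_on UNIV w"
    "continuous_on UNIV (partial_deriv i (partial_deriv i u))" "continuous_on UNIV (partial_deriv i (partial_deriv i w))" for i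
    using u' w' by auto
  have "(\<integral>x. u x * laplacian w x \<partial>lborel) = (\<Sum>i\<in>UNIV. \<integral>x. u x * partial_deriv i (partial_deriv i w) x \<partial>lborel)"
    unfolding laplacian_def sum_distrib_left
    by (intro Bochner_Integration.integral_sum integrable_compact_support[where R=R])
       (auto intro!: continuous_intros c simp: ppw0)
  also have "\<dots> = (\<Sum>i\<in>UNIV. \<integral>x. partial_deriv i (partial_deriv i u) x * w x \<partial>lborel)"
  proof (intro sum.cong refl)
    fix i
    show "(\<integral>x. u x * partial_deriv i (partial_deriv i w) x \<partial>lborel)
      = (\<integral>x. partial_deriv i (partial_deriv i u) x * w x \<partial>lborel)"
      using integral_by_parts[OF u'(1) w'(2)[of i] pw0, where i=i] integral_by_parts[OF u'(2)[of i] w'(1) w0, where i=i] by simp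
  qed
  also have "\<dots> = (\<integral>x. laplacian u x * w x \<partial>lborel)"
    unfolding laplacian_def sum_distrib_right
    by (intro Bochner_Integration.integral_sum[symmetric] integrable_compact_support[where R=R])
       (auto intro!: continuous_intros c simp: w0)
  finally show ?thesis .
qed

text \<open>Compact support is asked of \<open>w\<close> only, so that \<open>u\<close> can be the
  solution and \<open>w\<close> a test function. The induction strips the outermost Laplacian from
  \<open>w\<close> and applies it to \<open>u\<close> innermost.\<close>

lemma integral_iter_laplacian_swap:
  fixes u w :: "real^'n::finite \<Rightarrow> real"
  assumes "Ck_on (2 * k) UNIV u" "Ck_on (2 * k) UNIV w" and w0: "\<And>x. norm x > R \<Longrightarrow> w x = 0"
  shows "(\<integral>x. u x * iter_laplacian k w x \<partial>lborel) = (\<integral>x. iter_laplacian k u x * w x \<partial>lborel)"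
  using assms(1,2)
proof (induction k arbitrary: u)
  case (Suc k)
  have "Ck_on 2 UNIV u" using Suc.prems(1) by (rule Ck_on_mono) simp
  moreover have "Ck_on 2 UNIV (iter_laplacian k w)"
    using Suc.prems(2) by (intro Ck_on_iter_laplacian) (auto simp: numeral_2_eq_2 simp del: Ck_on.simps(2))
  ultimately have "(\<integral>x. u x * iter_laplacian (Suc k) w x \<partial>lborel) = (\<integral>x. laplacian u x * iter_laplacian k w x \<partial>lborel)"
    unfolding iter_laplacian_Suc
    by (rule integral_laplacian_swap[where R=R]) (auto intro: vanishing_outside_iter_laplacian w0)
  also have "\<dots> = (\<integral>x. iter_laplacian k (laplacian u) x * w x \<partial>lborel)"
    using Suc.prems by (intro Suc.IH Ck_on_laplacian) (auto simp del: Ck_on.simps(2) intro: Ck_on_mono)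
  finally show ?case by (simp add: iter_laplacian_Suc')
qed simp

section \<open>Jets of functions of one variable\<close>

text \<open>One-variable analogue of \<open>Ck_on\<close>. Continuity is demanded at the top order
  only, since differentiability at the points of \<open>S\<close> yields it below.\<close>

fun Dk_on :: "nat \<Rightarrow> real set \<Rightarrow> (real \<Rightarrow> real) \<Rightarrow> bool" where
  "Dk_on 0 S f = continuous_on S f"
| "Dk_on (Suc k) S f = ((\<forall>x\<in>S. f differentiable (at x)) \<and> Dk_on k S (deriv f))"

lemma Dk_on_imp_continuous_on: "Dk_on k S f \<Longrightarrow> continuous_on S f"
proof (cases k)
  case (Suc l)
  assume "Dk_on k S f"
  then have "f differentiable (at x within S)" if "x \<in> S" for x
    using that Suc by (auto intro: differentiable_at_withinI)
  then show ?thesis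
    by (auto simp: continuous_on_eq_continuous_within intro: differentiable_imp_continuous_within)
qed simp

lemma Dk_on_SucD: "Dk_on (Suc k) S f \<Longrightarrow> Dk_on k S f"
proof (induction k arbitrary: f)
  case 0
  then show ?case unfolding Dk_on.simps(1) by (rule Dk_on_imp_continuous_on)
qed auto

lemma Dk_on_mono: "Dk_on k S f \<Longrightarrow> l \<le> k \<Longrightarrow> Dk_on l S f"
  by (induction k) (auto simp: le_Suc_eq dest: Dk_on_SucD simp del: Dk_on.simps(2))

lemma Dk_on_subset: "Dk_on k S f \<Longrightarrow> T \<subseteq> S \<Longrightarrow> Dk_on k T f"
  by (induction k arbitrary: f) (auto intro: continuous_on_subset)

lemma Dk_on_Un: "open S \<Longrightarrow> open T \<Longrightarrow> Dk_on k S f \<Longrightarrow> Dk_on k T f \<Longrightarrow> Dk_on k (S \<union> T) f"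
  by (induction k arbitrary: f) (auto intro: continuous_on_open_Un)

lemma Dk_on_DERIV: "Dk_on (Suc k) S f \<Longrightarrow> x \<in> S \<Longrightarrow> (f has_real_derivative deriv f x) (at x)"
  by (simp add: DERIV_deriv_iff_real_differentiable)

lemma Dk_on_cong:
  assumes S: "open S" and "\<And>x. x \<in> S \<Longrightarrow> f x = g x"
  shows "Dk_on k S f \<Longrightarrow> Dk_on k S g"
  using assms(2)
proof (induction k arbitrary: f g)
  case 0
  then show ?case by (simp cong: continuous_on_cong)
next
  case (Suc k)
  have ev: "eventually (\<lambda>y. f y = g y) (nhds x)" if "x \<in> S" for x
    using eventually_nhds_in_open[OF S that] by eventually_elim (rule Suc.prems(2))
  have "g differentiable at x" if "x \<in> S" for x
  proof -
    have "(g has_real_derivative deriv f x) (at x)"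
      using Dk_on_DERIV[OF Suc.prems(1) that]
      by (rule has_field_derivative_transform_within_open[OF _ S that Suc.prems(2)])
    then show ?thesis by (auto simp: real_differentiable_def)
  qed
  moreover have "Dk_on k S (deriv g)"
  proof (rule Suc.IH)
    show "Dk_on k S (deriv f)" using Suc.prems(1) by simp
    show "deriv f x = deriv g x" if "x \<in> S" for x
      by (rule deriv_cong_ev[OF ev[OF that] refl])
  qed
  ultimately show ?case by simp
qed

lemma Dk_on_SucI:
  assumes "open S" "\<And>x. x \<in> S \<Longrightarrow> (f has_real_derivative f' x) (at x)" "Dk_on k S f'"
  shows "Dk_on (Suc k) S f"
proof -
  have "f' x = deriv f x" if "x \<in> S" for x
    using DERIV_imp_deriv[OF assms(2)[OF that]] by simp
  then have "Dk_on k S (deriv f)" by (rule Dk_on_cong[OF assms(1) _ assms(3)])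
  then show ?thesis using assms(2) by (auto simp: real_differentiable_def)
qed

lemma Dk_on_const: "open S \<Longrightarrow> Dk_on k S (\<lambda>_. c)"
proof (induction k arbitrary: c)
  case (Suc k)
  show ?case by (rule Dk_on_SucI[OF Suc.prems _ Suc.IH[OF Suc.prems, of 0]]) simp
qed simp

lemma Dk_on_ident: "open S \<Longrightarrow> Dk_on k S (\<lambda>x. x)"
proof (cases k)
  case (Suc l)
  assume S: "open S"
  show ?thesis unfolding Suc by (rule Dk_on_SucI[OF S DERIV_ident Dk_on_const[OF S]])
qed simp

lemma Dk_on_add:
  assumes S: "open S" shows "Dk_on k S f \<Longrightarrow> Dk_on k S g \<Longrightarrow> Dk_on k S (\<lambda>x. f x + g x)"
proof (induction k arbitrary: f g)
  case (Suc k)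
  have "Dk_on k S (\<lambda>x. deriv f x + deriv g x)"
    using Suc.prems by (intro Suc.IH) simp_all
  then show ?case
    by (rule Dk_on_SucI[OF S, rotated])
       (intro DERIV_add Dk_on_DERIV[OF Suc.prems(1)] Dk_on_DERIV[OF Suc.prems(2)])
qed (simp add: continuous_on_add)

lemma Dk_on_mult:
  assumes S: "open S" shows "Dk_on k S f \<Longrightarrow> Dk_on k S g \<Longrightarrow> Dk_on k S (\<lambda>x. f x * g x)"
proof (induction k arbitrary: f g)
  case (Suc k)
  have "Dk_on k S (\<lambda>x. deriv f x * g x + deriv g x * f x)"
    using Suc.prems Suc.prems[THEN Dk_on_SucD] by (intro Dk_on_add[OF S] Suc.IH) simp_all
  then show ?case
    by (rule Dk_on_SucI[OF S, rotated])
       (intro DERIV_mult Dk_on_DERIV[OF Suc.prems(1)] Dk_on_DERIV[OF Suc.prems(2)])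
qed (simp add: continuous_on_mult)

lemma Dk_on_power: "open S \<Longrightarrow> Dk_on k S f \<Longrightarrow> Dk_on k S (\<lambda>x. f x ^ n)"
  by (induction n) (simp_all add: Dk_on_const Dk_on_mult)

lemma Dk_on_inverse:
  assumes S: "open S" and nz: "\<And>x. x \<in> S \<Longrightarrow> f x \<noteq> 0" shows "Dk_on k S f \<Longrightarrow> Dk_on k S (\<lambda>x. inverse (f x))"
proof (induction k)
  case 0
  then show ?case using nz by (simp add: continuous_on_inverse)
next
  case (Suc k)
  have i: "Dk_on k S (\<lambda>x. inverse (f x))" by (rule Suc.IH[OF Dk_on_SucD[OF Suc.prems]])
  have "Dk_on k S (\<lambda>x. (-1) * ((inverse (f x) * deriv f x) * inverse (f x)))"
    using Suc.prems by (intro Dk_on_mult[OF S] i Dk_on_const S) simp_all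
  moreover have "((\<lambda>x. inverse (f x)) has_real_derivative (-1) * ((inverse (f x) * deriv f x) * inverse (f x))) (at x)"
    if "x \<in> S" for x
    using DERIV_inverse'[OF Dk_on_DERIV[OF Suc.prems that] nz[OF that]] by simp
  ultimately show ?case by (intro Dk_on_SucI[OF S])
qed

lemma Dk_on_compose_affine:
  assumes "open S" "Dk_on k S f"
  shows "Dk_on k ((\<lambda>x. a * x + b) -` S) (\<lambda>x. f (a * x + b))"
proof -
  have o: "open ((\<lambda>x. a * x + b) -` S)"
    by (intro open_vimage assms continuous_intros)
  show ?thesis using assms(2)
  proof (induction k arbitrary: f)
    case 0
    have "continuous_on ((\<lambda>x. a * x + b) -` S) (f \<circ> (\<lambda>x. a * x + b))"
      using 0 by (intro continuous_on_compose continuous_intros) (auto intro: continuous_on_subset)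
    then show ?case by (simp add: o_def)
  next
    case (Suc k)
    have "Dk_on k ((\<lambda>x. a * x + b) -` S) (\<lambda>x. a * deriv f (a * x + b))"
      using Suc.prems by (intro Dk_on_mult[OF o] Suc.IH Dk_on_const o) simp
    moreover have "((\<lambda>x. f (a * x + b)) has_real_derivative a * deriv f (a * x + b)) (at x)"
      if "x \<in> (\<lambda>x. a * x + b) -` S" for x
    proof -
      have "((\<lambda>x. a * x + b) has_real_derivative a) (at x)" by (auto intro!: derivative_eq_intros)
      from DERIV_chain2[OF Dk_on_DERIV[OF Suc.prems] this] that show ?thesis by (simp add: mult.commute[of a "deriv f _"])
    qed
    ultimately show ?case by (intro Dk_on_SucI[OF o])
  qed
qed

lemma Dk_on_ln: "Dk_on k {0<..} ln"
proof (cases k)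
  case 0
  then show ?thesis by (auto intro!: continuous_intros)
next
  case (Suc l)
  show ?thesis unfolding Suc
    by (rule Dk_on_SucI[OF _ _ Dk_on_inverse[OF _ _ Dk_on_ident]])
       (auto intro!: derivative_eq_intros simp: field_simps)
qed

section \<open>Truncated powers and cutoff functions\<close>

lemma DERIV_pos_part_power:
  "((\<lambda>t::real. max 0 t ^ Suc (Suc p)) has_real_derivative real (Suc (Suc p)) * max 0 t ^ Suc p) (at t)"
proof -
  consider "t < 0" | "t = 0" | "t > 0" by linarith
  then show ?thesis
  proof cases
    case 1
    have "((\<lambda>t::real. 0) has_real_derivative real (Suc (Suc p)) * max 0 t ^ Suc p) (at t)"
      using 1 by simp
    then show ?thesis
      by (rule has_field_derivative_transform_within_open[of _ _ _ "{..<0}"]) (use 1 in auto)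
  next
    case 2
    \<comment> \<open>At the corner the difference quotient equals \<open>max 0 h ^ Suc p\<close>
      for either sign of \<open>h\<close>, and this exponent is at least 1.\<close>
    have "((\<lambda>h. max 0 h ^ Suc (Suc p) / h) \<longlongrightarrow> 0) (at (0::real))"
    proof (rule tendsto_eq_rhs[OF Lim_transform_eventually])
      show "((\<lambda>h. max 0 h ^ Suc p) \<longlongrightarrow> max 0 0 ^ Suc p) (at (0::real))"
        by (intro tendsto_intros)
      show "eventually (\<lambda>h. max 0 h ^ Suc p = max 0 h ^ Suc (Suc p) / h) (at (0::real))"
        by (auto simp: eventually_at_filter max_def intro!: always_eventually)
    qed simp
    then show ?thesis using 2 by (simp add: DERIV_def)
  next
    case 3
    have "((\<lambda>t::real. t ^ Suc (Suc p)) has_real_derivative real (Suc (Suc p)) * max 0 t ^ Suc p) (at t)"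
      using 3 by (auto intro!: derivative_eq_intros simp del: power_Suc)
    then show ?thesis
      by (rule has_field_derivative_transform_within_open[of _ _ _ "{0<..}"]) (use 3 in auto)
  qed
qed

lemma Dk_on_pos_part_power: "Dk_on k UNIV (\<lambda>t. max 0 t ^ (Suc k))"
proof (induction k)
  case 0
  then show ?case by (auto intro!: continuous_intros)
next
  case (Suc k)
  show ?case
    by (rule Dk_on_SucI[OF open_UNIV DERIV_pos_part_power])
       (rule Dk_on_mult[OF open_UNIV Dk_on_const[OF open_UNIV] Suc.IH])
qed

text \<open>Finite smoothness is enough, so truncated powers replace the usual
  \<open>exp (- 1 / t)\<close>. The denominator never vanishes because \<open>a < b\<close> forces
  \<open>t > a\<close> or \<open>t < b\<close>.\<close>

lemma ex_cutoff:
  fixes a b :: real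
  assumes "a < b"
  obtains \<eta> where "Dk_on k UNIV \<eta>" "\<And>t. t \<le> a \<Longrightarrow> \<eta> t = 0" "\<And>t. b \<le> t \<Longrightarrow> \<eta> t = 1"
    "\<And>t. 0 \<le> \<eta> t" "\<And>t. \<eta> t \<le> 1"
proof
  define H where "H t = max 0 t ^ (Suc k)" for t :: real
  define \<eta> where "\<eta> t = H (t - a) * inverse (H (t - a) + H (b - t))" for t
  have H0: "H t \<ge> 0" for t unfolding H_def by simp
  have Hp: "H t > 0" if "t > 0" for t using that unfolding H_def by simp
  have Hz: "H t = 0" if "t \<le> 0" for t using that unfolding H_def by (simp add: max_def)
  have pos: "H (t - a) + H (b - t) > 0" for t
    using assms Hp[of "t - a"] Hp[of "b - t"] H0[of "t - a"] H0[of "b - t"] by (cases "t > a") auto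
  have D: "Dk_on k UNIV H" unfolding H_def by (rule Dk_on_pos_part_power)
  have D1: "Dk_on k UNIV (\<lambda>t. H (t - a))"
    using Dk_on_compose_affine[OF open_UNIV D, of 1 "-a"] by simp
  have D2: "Dk_on k UNIV (\<lambda>t. H (b - t))"
    using Dk_on_compose_affine[OF open_UNIV D, of "-1" b] by simp
  show "Dk_on k UNIV \<eta>" unfolding \<eta>_def
    by (intro Dk_on_mult Dk_on_inverse Dk_on_add D1 D2 open_UNIV) (use pos in \<open>auto simp: less_le\<close>)
  show "\<eta> t = 0" if "t \<le> a" for t using that by (simp add: \<eta>_def Hz)
  show "\<eta> t = 1" if "b \<le> t" for t using that pos[of t] Hz[of "b - t"] by (simp add: \<eta>_def)
  show "0 \<le> \<eta> t" for t using H0 by (simp add: \<eta>_def)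
  show "\<eta> t \<le> 1" for t using H0[of "b - t"] pos[of t] by (simp add: \<eta>_def field_simps)
qed

text \<open>In a jet, \<open>F j\<close> plays the role of the \<open>j\<close>-th derivative of \<open>F 0\<close>.\<close>

definition jets :: "nat \<Rightarrow> real set \<Rightarrow> (nat \<Rightarrow> real \<Rightarrow> real) \<Rightarrow> bool" where
  "jets k S F \<longleftrightarrow> (\<forall>j<k. \<forall>t\<in>S. (F j has_real_derivative F (Suc j) t) (at t)) \<and> (\<forall>j\<le>k. continuous_on S (F j))"

lemma jetsI:
  assumes "\<And>j t. j < k \<Longrightarrow> t \<in> S \<Longrightarrow> (F j has_real_derivative F (Suc j) t) (at t)" "continuous_on S (F k)"
  shows "jets k S F"
proof -
  have "continuous_on S (F j)" if "j \<le> k" for j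
  proof (cases "j = k")
    case False
    then have "isCont (F j) t" if "t \<in> S" for t
      using assms(1)[of j t] that \<open>j \<le> k\<close> by (auto intro: DERIV_isCont)
    then show ?thesis by (intro continuous_at_imp_continuous_on) auto
  qed (simp add: assms(2))
  with assms(1) show ?thesis by (simp add: jets_def)
qed

lemma jets_deriv: "Dk_on k S f \<Longrightarrow> jets k S (\<lambda>j. (deriv ^^ j) f)"
proof (induction k arbitrary: f)
  case (Suc k)
  have J: "jets k S (\<lambda>j. (deriv ^^ j) (deriv f))" using Suc by simp
  show ?case
  proof (rule jetsI)
    fix j t assume "j < Suc k" "t \<in> S"
    then show "((deriv ^^ j) f has_real_derivative (deriv ^^ Suc j) f t) (at t)"
    proof (cases j)
      case 0
      then show ?thesis using Suc.prems \<open>t \<in> S\<close> by (simp add: Dk_on_DERIV del: Dk_on.simps)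
    next
      case (Suc i)
      then show ?thesis using J \<open>t \<in> S\<close> \<open>j < Suc k\<close>
        unfolding Suc jets_def by (simp add: funpow_Suc_right del: funpow.simps)
    qed
  next
    show "continuous_on S ((deriv ^^ Suc k) f)"
      using J unfolding jets_def by (simp add: funpow_Suc_right del: funpow.simps)
  qed
qed (simp add: jets_def)

text \<open>Lets the derivatives of one function be read off from two formulas: agreement at order 0
  on an open set propagates by uniqueness of derivatives.\<close>

lemma jets_unique:
  assumes "open S" "jets k S F" "jets k S E" "\<And>t. t \<in> S \<Longrightarrow> F 0 t = E 0 t" "j \<le> k" "t \<in> S"
  shows "F j t = E j t"
  using assms(5,6)
proof (induction j arbitrary: t)
  case (Suc j)
  have "(E j has_real_derivative F (Suc j) t) (at t)"
    by (rule has_field_derivative_transform_within_open[of "F j" _ _ S])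
       (use assms(1,2) Suc in \<open>auto simp: jets_def\<close>)
  moreover have "(E j has_real_derivative E (Suc j) t) (at t)"
    using assms(3) Suc.prems by (auto simp: jets_def)
  ultimately show ?case by (rule DERIV_unique)
qed (simp add: assms(4))

lemma jets_tail: "jets (Suc k) S F \<Longrightarrow> jets k S (\<lambda>j. F (Suc j))"
  by (auto simp: jets_def)

lemma jets_mono: "jets k S F \<Longrightarrow> l \<le> k \<Longrightarrow> jets l S F"
  by (auto simp: jets_def)

lemma jets_subset: "jets k S F \<Longrightarrow> T \<subseteq> S \<Longrightarrow> jets k T F"
  by (auto simp: jets_def intro: continuous_on_subset)

lemma jets_mult:
  assumes F: "jets k S F" and G: "jets k S G"
  shows "jets k S (\<lambda>j t. \<Sum>l\<le>j. real (j choose l) * F l t * G (j - l) t)"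
proof (rule jetsI)
  fix j t assume j: "j < k" and t: "t \<in> S"
  have "((\<lambda>t. \<Sum>l\<le>j. real (j choose l) * F l t * G (j - l) t) has_real_derivative
     (\<Sum>l\<le>j. real (j choose l) * F l t * G (Suc (j - l)) t + real (j choose l) * F (Suc l) t * G (j - l) t)) (at t)"
  proof (rule DERIV_sum)
    fix l assume "l \<in> {..j}"
    then have "(F l has_real_derivative F (Suc l) t) (at t)" "(G (j - l) has_real_derivative G (Suc (j - l)) t) (at t)"
      using F G j t by (auto simp: jets_def)
    then show "((\<lambda>t. real (j choose l) * F l t * G (j - l) t) has_real_derivative
       real (j choose l) * F l t * G (Suc (j - l)) t + real (j choose l) * F (Suc l) t * G (j - l) t) (at t)"
      by (auto intro!: derivative_eq_intros simp: algebra_simps)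
  qed
  \<comment> \<open>Pascal's rule recombines the two halves of the summands into the coefficients
    \<open>Suc j choose l\<close>.\<close>
  also have "(\<Sum>l\<le>j. real (j choose l) * F l t * G (Suc (j - l)) t + real (j choose l) * F (Suc l) t * G (j - l) t)
    = (\<Sum>l\<le>Suc j. real (Suc j choose l) * F l t * G (Suc j - l) t)"
  proof -
    have "(\<Sum>l\<le>Suc j. real (Suc j choose l) * F l t * G (Suc j - l) t)
      = F 0 t * G (Suc j) t + (\<Sum>l\<le>j. real (j choose Suc l) * F (Suc l) t * G (j - l) t)
         + (\<Sum>l\<le>j. real (j choose l) * F (Suc l) t * G (j - l) t)"
      by (subst sum.atMost_Suc_shift) (simp add: algebra_simps sum.distrib)
    also have "F 0 t * G (Suc j) t + (\<Sum>l\<le>j. real (j choose Suc l) * F (Suc l) t * G (j - l) t)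
       = (\<Sum>l\<le>Suc j. real (j choose l) * F l t * G (Suc j - l) t)"
      by (subst sum.atMost_Suc_shift) simp
    also have "\<dots> = (\<Sum>l\<le>j. real (j choose l) * F l t * G (Suc (j - l)) t)"
      by (simp add: Suc_diff_le)
    finally show ?thesis by (simp add: sum.distrib)
  qed
  finally show "((\<lambda>t. \<Sum>l\<le>j. real (j choose l) * F l t * G (j - l) t) has_real_derivative
     (\<Sum>l\<le>Suc j. real (Suc j choose l) * F l t * G (Suc j - l) t)) (at t)" .
next
  show "continuous_on S (\<lambda>t. \<Sum>l\<le>k. real (k choose l) * F l t * G (k - l) t)"
    using F G by (intro continuous_intros) (auto simp: jets_def)
qed

text \<open>The Laplacian of \<open>y \<mapsto> F 0 (c * |y - p|\<^sup>2)\<close> in dimension \<open>2 * a\<close>, as an action on jets.\<close>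

definition rad_op :: "real \<Rightarrow> real \<Rightarrow> (nat \<Rightarrow> real \<Rightarrow> real) \<Rightarrow> nat \<Rightarrow> real \<Rightarrow> real" where
  "rad_op c a F j t = 4 * c * (t * F (j + 2) t + (a + real j) * F (j + 1) t)"

lemma jets_rad_op:
  assumes "jets (k + 2) S F" shows "jets k S (rad_op c a F)"
proof (rule jetsI)
  fix j t assume "j < k" "t \<in> S"
  then have "(F (j + 2) has_real_derivative F (j + 3) t) (at t)" "(F (j + 1) has_real_derivative F (j + 2) t) (at t)"
    using assms unfolding jets_def by (auto simp: numeral_3_eq_3 numeral_2_eq_2)
  then show "(rad_op c a F j has_real_derivative rad_op c a F (Suc j) t) (at t)"
    unfolding rad_op_def[abs_def]
    by (auto intro!: derivative_eq_intros simp: algebra_simps numeral_3_eq_3 numeral_2_eq_2)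
next
  show "continuous_on S (rad_op c a F k)" using assms
    unfolding rad_op_def[abs_def] jets_def by (intro continuous_intros) auto
qed

text \<open>Normal form of \<open>\<Delta> ^ k\<close> on radial functions. The induction treats all
  \<open>j\<close> at once, since one further application reads the orders \<open>j + 1\<close> and
  \<open>j + 2\<close>.\<close>

lemma rad_op_funpow:
  "(rad_op c a ^^ k) F j t = (4 * c) ^ k *
     (\<Sum>i\<le>k. real (k choose i) * pochhammer (a + real j + real i) (k - i) * t ^ i * F (j + k + i) t)"
proof (induction k arbitrary: j)
  case (Suc k)
  define x where "x = a + real j"
  \<comment> \<open>Comparison of the coefficients of \<open>t ^ Suc i\<close>: on the right, the
    first term comes from \<open>t * F (j + 2)\<close>, the second from
    \<open>(a + j) * F (j + 1)\<close>. For \<open>i < k\<close> all Pochhammer symbols share the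
    factor \<open>q\<close>, and binomial identities remain.\<close>
  have key: "real (Suc k choose Suc i) * pochhammer (x + real i + 1) (k - i)
    = real (k choose i) * pochhammer (x + real i + 2) (k - i)
      + x * real (k choose Suc i) * pochhammer (x + real i + 2) (k - Suc i)" if "i \<le> k" for i
  proof (cases "i = k")
    case False
    define q where "q = pochhammer (x + real i + 2) (k - Suc i)"
    have k: "k - i = Suc (k - Suc i)" using False that by simp
    have 1: "pochhammer (x + real i + 1) (k - i) = (x + real i + 1) * q"
      unfolding k pochhammer_rec q_def by (simp add: algebra_simps)
    have 2: "pochhammer (x + real i + 2) (k - i) = (x + real k + 1) * q"
      unfolding k pochhammer_rec' q_def using False that by (simp add: of_nat_diff algebra_simps)
    have b: "(real i + 1) * real (Suc k choose Suc i) = (real k + 1) * real (k choose i)"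
      using arg_cong[OF Suc_times_binomial[of i k], of real] by (simp only: of_nat_mult) (simp add: algebra_simps)
    have "real (Suc k choose Suc i) * (x + real i + 1) = x * real (Suc k choose Suc i) + (real i + 1) * real (Suc k choose Suc i)"
      by (simp add: algebra_simps)
    also have "\<dots> = real (k choose i) * (x + real k + 1) + x * real (k choose Suc i)"
      unfolding b by (simp add: algebra_simps)
    finally have "real (Suc k choose Suc i) * (x + real i + 1) * q = (real (k choose i) * (x + real k + 1) + x * real (k choose Suc i)) * q"
      by simp
    then show ?thesis unfolding 1 2 q_def[symmetric] by (simp add: algebra_simps)
  qed simp
  define c1 where "c1 i = real (k choose i) * pochhammer (x + real i + 2) (k - i)" for i
  define c2 where "c2 i = real (k choose i) * pochhammer (x + real i + 1) (k - i)" for i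
  define c3 where "c3 i = real (Suc k choose i) * pochhammer (x + real i) (Suc k - i)" for i
  define f where "f i = t ^ i * F (j + Suc k + i) t" for i
  have c3S: "c3 (Suc i) = c1 i + x * c2 (Suc i)" if "i \<le> k" for i
    using key[OF that] unfolding c1_def c2_def c3_def by (simp add: algebra_simps)
  have c30: "c3 0 = x * c2 0"
    unfolding c3_def c2_def by (simp add: pochhammer_rec algebra_simps)
  have "(\<Sum>i\<le>Suc k. c3 i * f i) = x * c2 0 * f 0 + (\<Sum>i\<le>k. (c1 i + x * c2 (Suc i)) * f (Suc i))"
    unfolding sum.atMost_Suc_shift c30 by (simp add: c3S)
  also have "\<dots> = (\<Sum>i\<le>k. c1 i * f (Suc i)) + x * (\<Sum>i\<le>Suc k. c2 i * f i)"
    unfolding sum.atMost_Suc_shift by (simp add: algebra_simps sum.distrib sum_distrib_left)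
  also have "(\<Sum>i\<le>Suc k. c2 i * f i) = (\<Sum>i\<le>k. c2 i * f i)" by (simp add: c2_def)
  also have "(\<Sum>i\<le>k. c1 i * f (Suc i)) = t * (\<Sum>i\<le>k. c1 i * (t ^ i * F (j + 2 + k + i) t))"
    by (simp add: f_def sum_distrib_left algebra_simps)
  finally have "(\<Sum>i\<le>Suc k. c3 i * f i) = t * (\<Sum>i\<le>k. c1 i * (t ^ i * F (j + 2 + k + i) t)) + x * (\<Sum>i\<le>k. c2 i * f i)" .
  moreover have "(rad_op c a ^^ Suc k) F j t =
      4 * c * ((4 * c) ^ k * (t * (\<Sum>i\<le>k. c1 i * (t ^ i * F (j + 2 + k + i) t)) + x * (\<Sum>i\<le>k. c2 i * f i)))"
    unfolding funpow.simps o_def rad_op_def[of c a "(rad_op c a ^^ k) F"] Suc.IH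
    by (simp add: x_def c1_def c2_def f_def algebra_simps)
  ultimately show ?case
    by (simp add: c3_def f_def x_def algebra_simps)
qed simp

section \<open>Polyharmonic operators on radial functions\<close>

lemma DERIV_norm_sq_line:
  fixes x p :: "real^'n::finite"
  shows "((\<lambda>t. c * (norm (x + t *\<^sub>R axis i 1 - p))\<^sup>2) has_real_derivative 2 * c * (x - p) $ i) (at 0)"
proof -
  have "c * (norm (x + t *\<^sub>R axis i 1 - p))\<^sup>2 = c * (norm (x - p))\<^sup>2 + 2 * c * (x - p) $ i * t + c * t\<^sup>2" for t
  proof -
    have "x + t *\<^sub>R axis i 1 - p = (x - p) + t *\<^sub>R axis i 1" by simp
    then have "(norm (x + t *\<^sub>R axis i 1 - p))\<^sup>2
      = (norm (x - p))\<^sup>2 + 2 * t * ((x - p) \<bullet> axis i 1) + t\<^sup>2 * (axis i (1::real) \<bullet> axis i (1::real))"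
      unfolding power2_norm_eq_inner by (simp add: inner_simps inner_commute power2_eq_square algebra_simps)
    also have "\<dots> = (norm (x - p))\<^sup>2 + 2 * t * (x - p) $ i + t\<^sup>2"
      by (simp add: inner_axis inner_axis_axis)
    finally show ?thesis by (simp add: distrib_left mult_ac)
  qed
  moreover have "((\<lambda>t. c * (norm (x - p))\<^sup>2 + 2 * c * (x - p) $ i * t + c * t\<^sup>2) has_real_derivative 2 * c * (x - p) $ i) (at 0)"
    by (auto intro!: derivative_eq_intros)
  ultimately show ?thesis by simp
qed

lemma DERIV_radial:
  fixes x p :: "real^'n::finite"
  assumes "(f has_real_derivative D) (at (c * (norm (x - p))\<^sup>2))"
  shows "((\<lambda>t. f (c * (norm (x + t *\<^sub>R axis i 1 - p))\<^sup>2)) has_real_derivative D * (2 * c * (x - p) $ i)) (at 0)"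
  using DERIV_chain2[of f D "\<lambda>t. c * (norm (x + t *\<^sub>R axis i 1 - p))\<^sup>2" 0, OF _ DERIV_norm_sq_line] assms
  by simp

text \<open>The variable is the squared distance, a polynomial in \<open>y\<close>, so the centre
  \<open>p\<close> is not singular. A partial derivative is a radial function of the shifted jet
  times a linear function, which closes the induction.\<close>

lemma Ck_on_radial:
  fixes p :: "real^'n::finite"
  assumes U: "open U" and "jets k S F" and S: "\<And>y. y \<in> U \<Longrightarrow> c * (norm (y - p))\<^sup>2 \<in> S"
  shows "Ck_on k U (\<lambda>y. F 0 (c * (norm (y - p))\<^sup>2))"
  using assms(2)
proof (induction k arbitrary: F)
  case 0
  then have "continuous_on S (F 0)" by (simp add: jets_def)
  then have "continuous_on U (F 0 \<circ> (\<lambda>y. c * (norm (y - p))\<^sup>2))"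
    by (intro continuous_on_compose continuous_intros) (auto intro: continuous_on_subset S)
  then show ?case by (simp add: o_def)
next
  case (Suc k)
  have "continuous_on S (F 0)" using Suc.prems by (simp add: jets_def)
  then have "continuous_on U (F 0 \<circ> (\<lambda>y. c * (norm (y - p))\<^sup>2))"
    by (intro continuous_on_compose continuous_intros) (auto intro: continuous_on_subset S)
  then have cont: "continuous_on U (\<lambda>y. F 0 (c * (norm (y - p))\<^sup>2))" by (simp add: o_def)
  have lin: "Ck_on k U (\<lambda>y. 2 * c * (y - p) $ i)" for i
  proof -
    have "Ck_on k U (\<lambda>y. (2 * c) * (y $ i + (- p $ i)))"
      by (intro Ck_on_mult Ck_on_add Ck_on_const Ck_on_coord U)
    then show ?thesis by simp
  qed
  show ?case
  proof (rule Ck_on_SucI[OF U cont])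
    fix i x assume x: "x \<in> U"
    have "(F 0 has_real_derivative F (Suc 0) (c * (norm (x - p))\<^sup>2)) (at (c * (norm (x - p))\<^sup>2))"
      using Suc.prems S[OF x] by (simp add: jets_def)
    then show "((\<lambda>t. F 0 (c * (norm (x + t *\<^sub>R axis i 1 - p))\<^sup>2)) has_real_derivative
        F (Suc 0) (c * (norm (x - p))\<^sup>2) * (2 * c * (x - p) $ i)) (at 0)"
      by (rule DERIV_radial)
  next
    show "Ck_on k U (\<lambda>x. F (Suc 0) (c * (norm (x - p))\<^sup>2) * (2 * c * (x - p) $ i))" for i
      by (rule Ck_on_mult[OF U Suc.IH[OF jets_tail[OF Suc.prems]] lin])
  qed
qed

lemma laplacian_radial:
  fixes p :: "real^'n::finite"
  assumes S: "open S" and F: "jets 2 S F" and y: "c * (norm (y - p))\<^sup>2 \<in> S"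
  shows "laplacian (\<lambda>y. F 0 (c * (norm (y - p))\<^sup>2)) y = rad_op c (real CARD('n) / 2) F 0 (c * (norm (y - p))\<^sup>2)"
proof -
  define U where "U = (\<lambda>y. c * (norm (y - p))\<^sup>2) -` S"
  have U: "open U" unfolding U_def by (intro open_vimage S continuous_intros)
  have yU: "y \<in> U" using y by (simp add: U_def)
  define T where "T = c * (norm (y - p))\<^sup>2"
  have d0: "(F 0 has_real_derivative F 1 t) (at t)" "(F 1 has_real_derivative F 2 t) (at t)" if "t \<in> S" for t
    using F that by (auto simp: jets_def numeral_2_eq_2)
  have p1: "partial_deriv i (\<lambda>y. F 0 (c * (norm (y - p))\<^sup>2)) z = F 1 (c * (norm (z - p))\<^sup>2) * (2 * c * (z - p) $ i)"
    if "z \<in> U" for z i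
    by (intro partial_deriv_eqI DERIV_radial d0) (use that in \<open>simp add: U_def\<close>)
  have p2: "partial_deriv i (partial_deriv i (\<lambda>y. F 0 (c * (norm (y - p))\<^sup>2))) y
     = 2 * c * F 1 T + 4 * c\<^sup>2 * ((y - p) $ i)\<^sup>2 * F 2 T" for i
  proof -
    have "partial_deriv i (partial_deriv i (\<lambda>y. F 0 (c * (norm (y - p))\<^sup>2))) y
      = partial_deriv i (\<lambda>z. F 1 (c * (norm (z - p))\<^sup>2) * (2 * c * (z - p) $ i)) y"
      by (rule partial_deriv_cong[OF U yU p1])
    also have "\<dots> = 2 * c * F 1 T + 4 * c\<^sup>2 * ((y - p) $ i)\<^sup>2 * F 2 T"
    proof (rule partial_deriv_eqI)
      have a: "((\<lambda>t. F 1 (c * (norm (y + t *\<^sub>R axis i 1 - p))\<^sup>2)) has_real_derivative F 2 T * (2 * c * (y - p) $ i)) (at 0)"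
        unfolding T_def by (rule DERIV_radial[OF d0(2)[OF y]])
      have b: "((\<lambda>t. 2 * c * (y + t *\<^sub>R axis i 1 - p) $ i) has_real_derivative 2 * c) (at 0)"
        by (auto intro!: derivative_eq_intros simp: axis_def)
      show "((\<lambda>t. F 1 (c * (norm (y + t *\<^sub>R axis i 1 - p))\<^sup>2) * (2 * c * (y + t *\<^sub>R axis i 1 - p) $ i))
         has_real_derivative 2 * c * F 1 T + 4 * c\<^sup>2 * ((y - p) $ i)\<^sup>2 * F 2 T) (at 0)"
        using DERIV_mult[OF a b] by (simp add: T_def power2_eq_square algebra_simps)
    qed
    finally show ?thesis .
  qed
  have n: "(\<Sum>i\<in>UNIV. ((y - p) $ i)\<^sup>2) = (norm (y - p))\<^sup>2"
    by (simp add: norm_vec_def L2_set_def sum_nonneg)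
  have "laplacian (\<lambda>y. F 0 (c * (norm (y - p))\<^sup>2)) y
    = (\<Sum>i\<in>UNIV. 2 * c * F 1 T + 4 * c\<^sup>2 * F 2 T * ((y - p) $ (i::'n))\<^sup>2)"
    unfolding laplacian_def p2 by (simp add: algebra_simps)
  also have "\<dots> = real CARD('n) * (2 * c * F 1 T) + 4 * c\<^sup>2 * F 2 T * (norm (y - p))\<^sup>2"
    unfolding n[symmetric] sum_distrib_left by (simp add: sum.distrib)
  also have "\<dots> = rad_op c (real CARD('n) / 2) F 0 T"
    by (simp add: rad_op_def T_def power2_eq_square algebra_simps numeral_2_eq_2[symmetric])
  finally show ?thesis by (simp add: T_def)
qed

lemma iter_laplacian_radial:
  fixes p :: "real^'n::finite"
  assumes S: "open S" and "jets (2 * k) S F" and "c * (norm (y - p))\<^sup>2 \<in> S"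
  shows "iter_laplacian k (\<lambda>y. F 0 (c * (norm (y - p))\<^sup>2)) y
    = (rad_op c (real CARD('n) / 2) ^^ k) F 0 (c * (norm (y - p))\<^sup>2)"
  using assms(2,3)
proof (induction k arbitrary: F y)
  case (Suc k)
  define U where "U = (\<lambda>y. c * (norm (y - p))\<^sup>2) -` S"
  have U: "open U" unfolding U_def by (intro open_vimage S continuous_intros)
  have J: "jets (2 * k) S (rad_op c (real CARD('n) / 2) F)" "jets 2 S F"
    using Suc.prems(1) by (auto intro: jets_rad_op jets_mono)
  have "iter_laplacian (Suc k) (\<lambda>y. F 0 (c * (norm (y - p))\<^sup>2)) y
     = iter_laplacian k (\<lambda>y. rad_op c (real CARD('n) / 2) F 0 (c * (norm (y - p))\<^sup>2)) y"
    unfolding iter_laplacian_Suc'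
    by (rule iter_laplacian_cong[OF U]) (use Suc.prems J in \<open>auto simp: U_def intro!: laplacian_radial[OF S]\<close>)
  also have "\<dots> = (rad_op c (real CARD('n) / 2) ^^ k) (rad_op c (real CARD('n) / 2) F) 0 (c * (norm (y - p))\<^sup>2)"
    by (rule Suc.IH[OF J(1) Suc.prems(2)])
  finally show ?case by (simp add: funpow_Suc_right del: funpow.simps)
qed simp

text \<open>Here order and dimension match: with \<open>a = m\<close> the coefficients of the normal
  form cancel the factorials in the derivatives of the logarithm. Both closed forms below rest on
  it.\<close>

lemma pochhammer_fact_ratio:
  assumes "i \<le> m" "m \<ge> 1"
  shows "pochhammer (real m + real i) (m - i) * fact (m + i - 1) = (fact (2 * m - 1) :: real)"
proof -
  have "(fact (2 * m - 1) :: real) = pochhammer 1 ((m + i - 1) + (m - i))"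
    using assms by (simp add: pochhammer_fact mult_2)
  also have "\<dots> = fact (m + i - 1) * pochhammer (real m + real i) (m - i)"
    unfolding pochhammer_product' using assms by (simp add: pochhammer_fact of_nat_diff)
  finally show ?thesis by simp
qed

text \<open>For odd \<open>m\<close> this is the reason why \<open>- ln (|y|\<^sup>2 + \<epsilon>)\<close> is an approximate fundamental solution
  of \<open>(- \<Delta>) ^ m\<close> in dimension \<open>2 * m\<close>: the result is a positive bubble whose mass
  does not depend on \<open>\<epsilon>\<close>.\<close>

lemma rad_op_log:
  assumes m: "m \<ge> 1" and s: "t + \<epsilon> > 0"
    and F: "\<And>j. j \<ge> 1 \<Longrightarrow> F j t = (-1) ^ j * fact (j - 1) / (t + \<epsilon>) ^ j"
  shows "(rad_op c (real m) ^^ m) F 0 t = (4 * c) ^ m * ((-1) ^ m * fact (2 * m - 1) * \<epsilon> ^ m / (t + \<epsilon>) ^ (2 * m))"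
proof -
  define s where "s = t + \<epsilon>"
  have sp: "s > 0" using s by (simp add: s_def)
  have summand: "real (m choose i) * pochhammer (real m + real i) (m - i) * t ^ i * F (m + i) t
    = (-1) ^ m * fact (2 * m - 1) / s ^ (2 * m) * (real (m choose i) * (- t) ^ i * s ^ (m - i))" if "i \<le> m" for i
  proof -
    have "F (m + i) t = (-1) ^ (m + i) * fact (m + i - 1) / s ^ (m + i)" using F[of "m + i"] m by (simp add: s_def)
    also have "1 / s ^ (m + i) = s ^ (m - i) / s ^ (2 * m)"
    proof -
      have "s ^ (2 * m) = s ^ (m + i) * s ^ (m - i)" using that by (simp add: power_add[symmetric] mult_2)
      then show ?thesis using sp by (simp add: field_simps)
    qed
    then have "(-1) ^ (m + i) * fact (m + i - 1) / s ^ (m + i) = (-1) ^ (m + i) * fact (m + i - 1) * (s ^ (m - i) / s ^ (2 * m))"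
      by (metis mult.right_neutral times_divide_eq_right)
    finally have "real (m choose i) * pochhammer (real m + real i) (m - i) * t ^ i * F (m + i) t
      = real (m choose i) * (pochhammer (real m + real i) (m - i) * fact (m + i - 1)) * t ^ i * (-1) ^ (m + i) * (s ^ (m - i) / s ^ (2 * m))"
      by (simp add: algebra_simps)
    also have "\<dots> = (-1) ^ m * fact (2 * m - 1) / s ^ (2 * m) * (real (m choose i) * ((-1) ^ i * t ^ i) * s ^ (m - i))"
      unfolding pochhammer_fact_ratio[OF that m] by (simp add: power_add algebra_simps)
    also have "(-1) ^ i * t ^ i = (- t) ^ i" by (simp add: power_mult_distrib[symmetric])
    finally show ?thesis .
  qed
  have "(\<Sum>i\<le>m. real (m choose i) * pochhammer (real m + real i) (m - i) * t ^ i * F (m + i) t)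
    = (-1) ^ m * fact (2 * m - 1) / s ^ (2 * m) * (\<Sum>i\<le>m. real (m choose i) * (- t) ^ i * s ^ (m - i))"
    unfolding sum_distrib_left by (intro sum.cong refl summand) simp
  \<comment> \<open>The binomial theorem collapses the sum, and \<open>s - t = \<epsilon>\<close>:
    only the bubble is left.\<close>
  also have "(\<Sum>i\<le>m. real (m choose i) * (- t) ^ i * s ^ (m - i)) = (- t + s) ^ m"
    using binomial_ring[of "- t" s m] by simp
  also have "- t + s = \<epsilon>" by (simp add: s_def)
  finally show ?thesis unfolding rad_op_funpow by (simp add: s_def)
qed

text \<open>That is, \<open>\<Delta> ^ m (F (|y|\<^sup>2)) = 4 ^ m * D ^ (2 * m - 1) (t ^ m * F')\<close> at \<open>t = |y|\<^sup>2\<close>, so prescribing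
  \<open>t ^ m * F'\<close> controls the sign of the polyharmonic operator.\<close>

lemma rad_op_divergence_form:
  assumes m: "m \<ge> 1" and S: "open S" "t \<in> S" and F: "jets (2 * m) S F" and E: "jets (2 * m - 1) S E"
    and FE: "\<And>t. t \<in> S \<Longrightarrow> t ^ m * F 1 t = E 0 t"
  shows "(rad_op c (real m) ^^ m) F 0 t = (4 * c) ^ m * E (2 * m - 1) t"
proof -
  \<comment> \<open>\<open>A l\<close> is the \<open>l\<close>-th derivative of
    \<open>t ^ m\<close>, zero for \<open>l > m\<close>, so Leibniz's rule for
    \<open>t ^ m * F 1 t\<close> has only \<open>m + 1\<close> terms.\<close>
  define A where "A l t = (if l \<le> m then fact m / fact (m - l) * t ^ (m - l) else 0)" for l and t :: real
  have A: "jets (2 * m - 1) S A"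
  proof (rule jetsI)
    fix j t
    show "(A j has_real_derivative A (Suc j) t) (at t)"
    proof (cases "j < m")
      case True
      then obtain q where q: "m - j = Suc q" by (cases "m - j") auto
      then have q': "m - Suc j = q" by simp
      have "((\<lambda>t. fact m / fact (Suc q) * t ^ Suc q) has_real_derivative fact m / fact (Suc q) * (real (Suc q) * t ^ q)) (at t)"
        by (auto intro!: derivative_eq_intros simp del: power_Suc)
      moreover have "fact m / fact (Suc q) * (real (Suc q) * t ^ q) = fact m / fact q * t ^ q"
        by (simp add: fact_Suc del: of_nat_Suc)
      moreover have "A j = (\<lambda>t. fact m / fact (Suc q) * t ^ Suc q)" "A (Suc j) t = fact m / fact q * t ^ q"
        using True q q' unfolding A_def[abs_def] by simp_all
      ultimately show ?thesis by (simp only:)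
    next
      case False
      then have "A j = (\<lambda>_. if j = m then fact m else 0)" by (auto simp: A_def fun_eq_iff)
      then show ?thesis using False by (simp add: A_def)
    qed
  next
    show "continuous_on S (A (2 * m - 1))" 
      unfolding A_def by (cases "2 * m - 1 \<le> m") (auto intro!: continuous_intros)
  qed
  have F': "jets (2 * m - 1) S (\<lambda>j. F (Suc j))" using F m by (intro jets_tail) simp
  have "(\<Sum>l\<le>2 * m - 1. real (2 * m - 1 choose l) * A l t * F (Suc (2 * m - 1 - l)) t) = E (2 * m - 1) t"
    by (rule jets_unique[OF S(1) jets_mult[OF A F'] E _ order_refl S(2)]) (use FE in \<open>simp add: A_def\<close>)
  also have "(\<Sum>l\<le>2 * m - 1. real (2 * m - 1 choose l) * A l t * F (Suc (2 * m - 1 - l)) t)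
    = (\<Sum>l\<le>m. real (2 * m - 1 choose l) * A l t * F (Suc (2 * m - 1 - l)) t)"
    using m by (intro sum.mono_neutral_right) (auto simp: A_def)
  \<comment> \<open>Read backwards through \<open>l = m - i\<close>, the Leibniz coefficients are
    those of \<open>rad_op_funpow\<close>.\<close>
  also have "\<dots> = (\<Sum>i\<le>m. real (m choose i) * pochhammer (real m + real i) (m - i) * t ^ i * F (m + i) t)"
  proof (rule sum.reindex_bij_witness[of _ "\<lambda>i. m - i" "\<lambda>i. m - i"])
    fix l assume "l \<in> {..m}"
    then have l: "l \<le> m" by simp
    define i where "i = m - l"
    have i: "l = m - i" "i \<le> m" using l by (auto simp: i_def)
    have e: "Suc (2 * m - 1 - l) = m + i" "2 * m - 1 - (m - i) = m + i - 1" "m - (m - i) = i" using i m by auto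
    have "real (2 * m - 1 choose (m - i)) = fact (2 * m - 1) / (fact (m - i) * fact (m + i - 1))"
      using binomial_fact[of "m - i" "2 * m - 1", where 'a=real] e m by simp
    also have "\<dots> = pochhammer (real m + real i) (m - i) / fact (m - i)"
      unfolding pochhammer_fact_ratio[OF i(2) m, symmetric] by simp
    finally have coeff: "real (2 * m - 1 choose (m - i)) * (fact m / fact i) = real (m choose i) * pochhammer (real m + real i) (m - i)"
      using binomial_fact[OF i(2), where 'a=real] by (simp add: mult_ac)
    have "real (2 * m - 1 choose (m - i)) * A (m - i) t * F (m + i) t
        = (real (2 * m - 1 choose (m - i)) * (fact m / fact i)) * t ^ i * F (m + i) t"
      using e by (simp add: A_def)
    also have "\<dots> = real (m choose i) * pochhammer (real m + real i) (m - i) * t ^ i * F (m + i) t"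
      unfolding coeff ..
    finally show "real (m choose (m - l)) * pochhammer (real m + real (m - l)) (m - (m - l)) * t ^ (m - l) * F (m + (m - l)) t
       = real (2 * m - 1 choose l) * A l t * F (Suc (2 * m - 1 - l)) t"
      unfolding i_def[symmetric] e(1) i(1)[symmetric] by (rule sym)
  qed auto
  finally show ?thesis unfolding rad_op_funpow by simp
qed

section \<open>The local estimate\<close>

lemma integrable_indicator_continuous:
  fixes f :: "real^'n::finite \<Rightarrow> real"
  assumes f: "continuous_on UNIV f" and A: "A \<in> sets borel" "bounded A"
  shows "integrable lborel (\<lambda>x. indicator A x * f x)"
proof -
  obtain r where r: "A \<subseteq> cball 0 r" using A(2) by (auto simp: bounded_iff subset_iff)
  show ?thesis
  proof (rule Bochner_Integration.integrable_bound)
    show "integrable lborel (\<lambda>x. indicator (cball 0 r) x *\<^sub>R f x)"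
      by (intro borel_integrable_compact continuous_on_subset[OF f]) auto
    show "(\<lambda>x. indicator A x * f x) \<in> borel_measurable lborel"
      using borel_measurable_continuous_onI[OF f] A(1) by auto
    show "AE x in lborel. norm (indicator A x * f x) \<le> norm (indicator (cball 0 r) x *\<^sub>R f x)"
      using r by (intro AE_I2) (auto simp: indicator_def subset_iff)
  qed
qed

lemma integral_indicator_ball:
  fixes a :: "real^'n::finite"
  assumes "r \<ge> 0"
  shows "(\<integral>x. indicator (ball a r) x \<partial>lborel) = unit_ball_vol (real CARD('n)) * r ^ CARD('n)"
    and "integrable lborel (indicator (ball a r) :: _ \<Rightarrow> real)"
  using content_ball[OF assms, of a] emeasure_bounded_finite[of "ball a r"]
  by (simp_all add: integrable_indicator_iff)

text \<open>The logarithm is untouched on \<open>s \<le> 1/2\<close>, where the exact bubble is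
  computed, and is cut off by the time \<open>- ln s\<close> changes sign at 1; hence both
  \<open>0 \<le> h s\<close> and, up to 1, \<open>h s \<le> - ln s\<close>.\<close>

lemma ex_log_cutoff:
  obtains h :: "real \<Rightarrow> real" where "Dk_on k {0<..} h" "\<And>s. 0 < s \<Longrightarrow> s \<le> 1/2 \<Longrightarrow> h s = - ln s"
    "\<And>s. 1 \<le> s \<Longrightarrow> h s = 0" "\<And>s. 0 < s \<Longrightarrow> 0 \<le> h s" "\<And>s. 0 < s \<Longrightarrow> s \<le> 1 \<Longrightarrow> h s \<le> - ln s"
proof -
  obtain \<eta> where e: "Dk_on k UNIV \<eta>" "\<And>t. t \<le> 1/2 \<Longrightarrow> \<eta> t = 0" "\<And>t. (1::real) \<le> t \<Longrightarrow> \<eta> t = 1"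
    "\<And>t. 0 \<le> \<eta> t" "\<And>t. \<eta> t \<le> 1" using ex_cutoff[of "1/2" "1::real" k] by auto
  define h where "h s = (1 + (-1) * \<eta> s) * ((-1) * ln s)" for s
  have "Dk_on k {0<..} \<eta>" using e(1) by (rule Dk_on_subset) simp
  then have 1: "Dk_on k {0<..} h" unfolding h_def
    by (intro Dk_on_mult Dk_on_add Dk_on_const Dk_on_ln) auto
  have 2: "0 \<le> h s" if "0 < s" for s
  proof (cases "s \<le> 1")
    case True then show ?thesis using that e(5)[of s] by (simp add: h_def mult_nonneg_nonpos)
  qed (simp add: h_def e(3))
  have 3: "h s \<le> - ln s" if "0 < s" "s \<le> 1" for s
    using mult_left_le_one_le[of "- ln s" "1 - \<eta> s"] that e(4,5)[of s] by (simp add: h_def)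
  show ?thesis
    by (rule that[OF 1 _ _ 2 3]) (use e in \<open>auto simp: h_def\<close>)
qed

lemma higher_deriv_shift: "(deriv ^^ j) (\<lambda>t. h (t + e)) = (\<lambda>t. (deriv ^^ j) h (t + e :: real))"
proof (induction j)
  case (Suc j)
  have "deriv (\<lambda>t. g (t + e)) t = deriv g (t + e)" for g and t :: real
    unfolding deriv_def by (simp add: DERIV_shift)
  then show ?case using Suc by auto
qed simp

lemma jets_minus_log: "jets k {0<..} (\<lambda>j s. if j = 0 then - ln s else (-1) ^ j * fact (j - 1) / s ^ j)"
proof (rule jetsI)
  fix j and t :: real assume t: "t \<in> {0<..}"
  show "((\<lambda>s. if j = 0 then - ln s else (-1) ^ j * fact (j - 1) / s ^ j) has_real_derivative
     (if Suc j = 0 then - ln t else (-1) ^ Suc j * fact (Suc j - 1) / t ^ Suc j)) (at t)"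
  proof (cases j)
    case 0
    then show ?thesis using t by (auto intro!: derivative_eq_intros simp: field_simps)
  next
    case (Suc i)
    have "((\<lambda>s. (-1) ^ j * fact i * inverse (s ^ Suc i)) has_real_derivative
       (-1) ^ j * fact i * (- (inverse (t ^ Suc i) * (real (Suc i) * t ^ i) * inverse (t ^ Suc i)))) (at t)"
      using t by (auto intro!: derivative_eq_intros simp del: power_Suc of_nat_Suc)
    also have "(-1) ^ j * fact i * (- (inverse (t ^ Suc i) * (real (Suc i) * t ^ i) * inverse (t ^ Suc i)))
      = (-1) ^ Suc j * fact (Suc i) / t ^ Suc (Suc i)"
      using t by (simp add: field_simps fact_Suc del: of_nat_Suc)
    finally show ?thesis using Suc by (simp add: divide_inverse)
  qed
next
  show "continuous_on {0<..} (\<lambda>s::real. if k = 0 then - ln s else (-1) ^ k * fact (k - 1) / s ^ k)"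
    by (cases k) (auto intro!: continuous_intros)
qed

text \<open>Discrete layer cake: for \<open>x > 0\<close> the right side counts the layers
  \<open>k < x\<close>, that is, \<open>x\<close> rounded up.\<close>

lemma le_sum_indicator_less: "x \<le> real K \<Longrightarrow> x \<le> (\<Sum>k<K. if real k < x then 1 else 0 :: real)"
proof (induction K)
  case (Suc K)
  show ?case
  proof (cases "x \<le> real K")
    case True
    then show ?thesis using Suc.IH by simp
  next
    case False
    then have "(\<Sum>k<Suc K. if real k < x then 1 else 0 :: real) = (\<Sum>k<Suc K. 1)"
      by (intro sum.cong) auto
    then show ?thesis using Suc.prems by simp
  qed
qed simp

text \<open>Dominating the logarithm by finitely many layers bounds its integral over a ball
  uniformly in the regularisation \<open>e\<close>.\<close>

lemma ln_le_sum_indicators: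
  fixes \<rho> e r :: real
  assumes "\<rho> > 0" "e > 0" "r \<ge> 0" and K: "ln (\<rho>\<^sup>2 / e) / 2 \<le> real K"
  shows "ln (\<rho>\<^sup>2 / (r\<^sup>2 + e)) \<le> 2 * (\<Sum>k<K. if r < \<rho> * exp (- real k) then 1 else 0)"
proof -
  define x where "x = ln (\<rho>\<^sup>2 / (r\<^sup>2 + e)) / 2"
  have re: "r\<^sup>2 + e > 0" using assms(2) by (simp add: add_nonneg_pos)
  have "\<rho>\<^sup>2 / (r\<^sup>2 + e) \<le> \<rho>\<^sup>2 / e" using assms by (intro divide_left_mono) (auto intro: mult_pos_pos re)
  then have "x \<le> ln (\<rho>\<^sup>2 / e) / 2" using assms(1,2) re unfolding x_def by simp
  then have "x \<le> (\<Sum>k<K. if real k < x then 1 else 0)" using K by (intro le_sum_indicator_less) simp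
  also have "\<dots> \<le> (\<Sum>k<K. if r < \<rho> * exp (- real k) then 1 else 0)"
  proof (intro sum_mono)
    fix k
    \<comment> \<open>\<open>exp (2 * x)\<close> is the quotient under the logarithm, so exceeding
      level \<open>k\<close> forces \<open>r\<close> into a ball shrunk by
      \<open>exp (- real k)\<close>.\<close>
    have "r < \<rho> * exp (- real k)" if "real k < x"
    proof -
      have "exp (2 * x) = \<rho>\<^sup>2 / (r\<^sup>2 + e)" using assms(1) re by (simp add: x_def)
      then have "r\<^sup>2 + e = \<rho>\<^sup>2 * exp (- (2 * x))" using re by (simp add: exp_minus field_simps)
      also have "\<dots> = (\<rho> * exp (- x))\<^sup>2" by (simp add: power_mult_distrib exp_double[symmetric])
      finally have "r\<^sup>2 < (\<rho> * exp (- x))\<^sup>2" using assms(2) by simp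
      then have "r < \<rho> * exp (- x)" using assms(1) by (simp add: power2_less_imp_less)
      also have "\<dots> \<le> \<rho> * exp (- real k)" using that assms(1) by simp
      finally show ?thesis .
    qed
    then show "(if real k < x then 1 else 0 :: real) \<le> (if r < \<rho> * exp (- real k) then 1 else 0)" by auto
  qed
  finally show ?thesis by (simp add: x_def)
qed

text \<open>Bounds the total volume of the layers by a multiple of the largest one, whatever their
  number \<open>K\<close>.\<close>

lemma sum_exp_power_le:
  assumes "n \<ge> 1" shows "(\<Sum>k<K. exp (- real k) ^ n) \<le> 2"
proof -
  have "exp (- real k) ^ n \<le> (1/2) ^ k" for k
  proof -
    have "exp (- real k) ^ n \<le> exp (- real k) ^ 1" using assms by (intro power_decreasing) auto
    also have "\<dots> = exp (- 1) ^ k" by (simp add: exp_of_nat_mult[symmetric])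
    also have "\<dots> \<le> (1/2) ^ k"
    proof (intro power_mono)
      have "(2::real) \<le> exp 1" using exp_ge_add_one_self[of 1] by simp
      then show "exp (- 1 :: real) \<le> 1/2" by (simp add: exp_minus field_simps)
    qed simp
    finally show ?thesis .
  qed
  then have "(\<Sum>k<K. exp (- real k) ^ n) \<le> (\<Sum>k<K. (1/2) ^ k)" by (intro sum_mono)
  also have "\<dots> \<le> 2" by (subst sum_gp_strict) simp
  finally show ?thesis .
qed

text \<open>In the transition zone \<open>t + e\<close> stays in a compact interval away from 0, so
  the bound is uniform in the regularisation \<open>e\<close>. The scale enters only through
  \<open>c\<close>.\<close>

lemma rad_op_bounded_on_compact:
  assumes "Dk_on (2 * m) {0<..} h"
  obtains B where "B \<ge> 0" "\<And>t e c. 0 \<le> t \<Longrightarrow> t \<le> 1 \<Longrightarrow> 1/2 \<le> t + e \<Longrightarrow> t + e \<le> 1 \<Longrightarrow> c \<ge> 0 \<Longrightarrow>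
    \<bar>(rad_op c (real m) ^^ m) (\<lambda>j t. (deriv ^^ j) h (t + e)) 0 t\<bar> \<le> (4 * c) ^ m * B"
proof -
  have "\<exists>b. \<forall>s\<in>{1/2..1}. \<bar>(deriv ^^ k) h s\<bar> \<le> b" if "k \<le> 2 * m" for k
  proof -
    have "continuous_on {0<..} ((deriv ^^ k) h)" using jets_deriv[OF assms] that by (simp add: jets_def)
    then have "compact ((deriv ^^ k) h ` {1/2..1})"
      by (intro compact_continuous_image) (auto intro: continuous_on_subset)
    then show ?thesis by (auto dest!: compact_imp_bounded simp: bounded_iff)
  qed
  then obtain b where b: "\<And>k s. k \<le> 2 * m \<Longrightarrow> s \<in> {1/2..1} \<Longrightarrow> \<bar>(deriv ^^ k) h s\<bar> \<le> b k"
    by metis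
  define B where "B = (\<Sum>i\<le>m. real (m choose i) * pochhammer (real m + real i) (m - i) * \<bar>b (m + i)\<bar>)"
  have poch: "pochhammer (real m + real i) (m - i) \<ge> 0" for i by (simp add: pochhammer_prod prod_nonneg)
  show ?thesis
  proof
    show "B \<ge> 0" unfolding B_def using poch by (intro sum_nonneg mult_nonneg_nonneg) auto
    fix t e c :: real assume t: "0 \<le> t" "t \<le> 1" "1/2 \<le> t + e" "t + e \<le> 1" and c: "c \<ge> 0"
    have "\<bar>\<Sum>i\<le>m. real (m choose i) * pochhammer (real m + real i) (m - i) * t ^ i * (deriv ^^ (m + i)) h (t + e)\<bar> \<le> B"
      unfolding B_def
    proof (intro order_trans[OF sum_abs] sum_mono)
      fix i assume i: "i \<in> {..m}"
      have "\<bar>t ^ i * (deriv ^^ (m + i)) h (t + e)\<bar> \<le> 1 * \<bar>b (m + i)\<bar>"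
        unfolding abs_mult using t b[of "m + i" "t + e"] i
        by (intro mult_mono) (auto simp: power_le_one)
      then have "real (m choose i) * pochhammer (real m + real i) (m - i) * \<bar>t ^ i * (deriv ^^ (m + i)) h (t + e)\<bar>
        \<le> real (m choose i) * pochhammer (real m + real i) (m - i) * \<bar>b (m + i)\<bar>"
        using poch[of i] by (intro mult_left_mono) auto
      then show "\<bar>real (m choose i) * pochhammer (real m + real i) (m - i) * t ^ i * (deriv ^^ (m + i)) h (t + e)\<bar>
        \<le> real (m choose i) * pochhammer (real m + real i) (m - i) * \<bar>b (m + i)\<bar>"
        using poch[of i] by (simp add: abs_mult mult.assoc)
    qed
    then show "\<bar>(rad_op c (real m) ^^ m) (\<lambda>j t. (deriv ^^ j) h (t + e)) 0 t\<bar> \<le> (4 * c) ^ m * B"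
      unfolding rad_op_funpow using c by (simp add: abs_mult mult_left_mono)
  qed
qed

text \<open>On the core \<open>t < \<epsilon>\<close> the bubble has height of order
  \<open>1 / \<epsilon> ^ m\<close>, which balances the volume of the core, of order
  \<open>\<epsilon> ^ m\<close>.\<close>

lemma bubble_lower_bound:
  fixes t \<epsilon> :: real
  assumes "0 \<le> t" "t < \<epsilon>"
  shows "\<epsilon> ^ m / (t + \<epsilon>) ^ (2 * m) \<ge> 1 / (4 ^ m * \<epsilon> ^ m)"
proof -
  have e: "\<epsilon> > 0" using assms by simp
  have "(t + \<epsilon>) ^ (2 * m) \<le> (2 * \<epsilon>) ^ (2 * m)" using assms by (intro power_mono) auto
  also have "\<dots> = 4 ^ m * \<epsilon> ^ m * \<epsilon> ^ m"
    by (simp add: power_mult power_mult_distrib power2_eq_square)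
  finally have "\<epsilon> ^ m / (t + \<epsilon>) ^ (2 * m) \<ge> \<epsilon> ^ m / (4 ^ m * \<epsilon> ^ m * \<epsilon> ^ m)"
    using assms e by (intro divide_left_mono mult_pos_pos zero_less_power) auto
  then show ?thesis using e by simp
qed

text \<open>The test function is a truncation of \<open>- ln (|y - y1|\<^sup>2 / d\<^sup>2 + \<epsilon>)\<close>, with \<open>\<epsilon>\<close> so small
  (depending on \<open>V\<close>) that \<open>V \<ge> V y1 / 2\<close> where the bubble concentrates; all constants are
  independent of \<open>\<epsilon>\<close>.\<close>

lemma local_estimate:
  assumes dim: "CARD('n::finite) = 2 * m" and m: "odd m"
  obtains c C where "c > 0" "C \<ge> 0"
    "\<And>(V :: real^'n \<Rightarrow> real) y1 d \<rho> \<Gamma>. Ck_on (2 * m) UNIV V \<Longrightarrow> (\<And>y. V y \<ge> 0) \<Longrightarrow> 0 < \<rho> \<Longrightarrow> \<rho> \<le> d \<Longrightarrow>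
      (\<And>y. y \<in> ball y1 d \<Longrightarrow> 0 \<le> - iter_laplacian m V y \<and> - iter_laplacian m V y \<le> \<Gamma>) \<Longrightarrow>
      c * V y1 \<le> C / d ^ (2 * m) * (\<integral>y. indicator (ball y1 d) y * V y \<partial>lborel)
        + ln (d\<^sup>2 / \<rho>\<^sup>2) * (\<integral>y. indicator (ball y1 d) y * - iter_laplacian m V y \<partial>lborel)
        + 4 * unit_ball_vol (2 * real m) * \<rho> ^ (2 * m) * \<Gamma>"
proof -
  have m1: "m \<ge> 1" using m by (cases m) auto
  have a: "real CARD('n) / 2 = real m" using dim by simp
  obtain h where h: "Dk_on (2 * m) {0<..} h" "\<And>s. 0 < s \<Longrightarrow> s \<le> 1/2 \<Longrightarrow> h s = - ln s"
    "\<And>s. 1 \<le> s \<Longrightarrow> h s = 0" "\<And>s. 0 < s \<Longrightarrow> 0 \<le> h s" "\<And>s. 0 < s \<Longrightarrow> s \<le> 1 \<Longrightarrow> h s \<le> - ln s"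
    by (rule ex_log_cutoff[of "2 * m"]) blast
  obtain B where B: "B \<ge> 0" "\<And>t e c. 0 \<le> t \<Longrightarrow> t \<le> 1 \<Longrightarrow> 1/2 \<le> t + e \<Longrightarrow> t + e \<le> 1 \<Longrightarrow> c \<ge> 0 \<Longrightarrow>
    \<bar>(rad_op c (real m) ^^ m) (\<lambda>j t. (deriv ^^ j) h (t + e)) 0 t\<bar> \<le> (4 * c) ^ m * B"
    using rad_op_bounded_on_compact[OF h(1)] by blast
  define \<omega> where "\<omega> = unit_ball_vol (2 * real m)"
  have \<omega>: "\<omega> > 0" by (simp add: \<omega>_def)
  \<comment> \<open>The bound for the height of the bubble times the volume of its core is
    \<open>fact (2 * m - 1) * \<omega>\<close>; a factor 1/2 is lost in
    \<open>V y \<ge> V y1 / 2\<close>.\<close>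
  define c where "c = fact (2 * m - 1) * \<omega> / 2"
  define C where "C = 4 ^ m * B"
  have "c * V y1 \<le> C / d ^ (2 * m) * (\<integral>y. indicator (ball y1 d) y * V y \<partial>lborel)
        + ln (d\<^sup>2 / \<rho>\<^sup>2) * (\<integral>y. indicator (ball y1 d) y * - iter_laplacian m V y \<partial>lborel)
        + 4 * \<omega> * \<rho> ^ (2 * m) * \<Gamma>"
    if V: "Ck_on (2 * m) UNIV V" "\<And>y. V y \<ge> 0" and \<rho>: "0 < \<rho>" "\<rho> \<le> d"
      and G: "\<And>y. y \<in> ball y1 d \<Longrightarrow> 0 \<le> - iter_laplacian m V y \<and> - iter_laplacian m V y \<le> \<Gamma>"
    for V :: "real^'n \<Rightarrow> real" and y1 d \<rho> \<Gamma>
  proof -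
    have d: "d > 0" using \<rho> by simp
    have contV: "continuous_on UNIV V" using V(1) by (rule Ck_on_imp_continuous_on)
    define g where "g y = - iter_laplacian m V y" for y
    have contg: "continuous_on UNIV g" unfolding g_def
      using Ck_on_iter_laplacian[OF open_UNIV, of 0 m V] V(1) by (simp add: continuous_on_minus)
    have g0: "0 \<le> g y" "g y \<le> \<Gamma>" if "y \<in> ball y1 d" for y using G[OF that] by (auto simp: g_def)
    have \<Gamma>: "\<Gamma> \<ge> 0" using g0[of y1] d by auto
    obtain \<delta> where \<delta>: "\<delta> > 0" "\<And>y. dist y y1 < \<delta> \<Longrightarrow> V y \<ge> V y1 / 2"
    proof (cases "V y1 = 0")
      case True
      then show ?thesis using that[of 1] V(2) by simp
    next
      case False
      then have "V y1 / 2 > 0" using V(2)[of y1] by simp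
      then obtain \<delta> where \<delta>: "\<delta> > 0" "\<And>y. dist y y1 < \<delta> \<Longrightarrow> dist (V y) (V y1) < V y1 / 2"
        using contV unfolding continuous_on_iff by (metis UNIV_I)
      show ?thesis
      proof (rule that[OF \<delta>(1)])
        fix y assume "dist y y1 < \<delta>"
        from \<delta>(2)[OF this] show "V y \<ge> V y1 / 2" unfolding dist_real_def by linarith
      qed
    qed
    \<comment> \<open>The bound 1/8 keeps the core \<open>T y < \<epsilon>\<close> inside the zone
      \<open>T y + \<epsilon> < 1/2\<close> of the exact formula; the other bound keeps it where
      \<open>V y \<ge> V y1 / 2\<close>.\<close>
    define \<epsilon> where "\<epsilon> = min (1/8) ((\<delta> / (2 * d))\<^sup>2)"
    have \<epsilon>: "0 < \<epsilon>" "\<epsilon> \<le> 1/8" using \<delta>(1) d by (auto simp: \<epsilon>_def)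
    have se: "sqrt \<epsilon> * d < \<delta>"
    proof -
      have "sqrt \<epsilon> \<le> sqrt ((\<delta> / (2 * d))\<^sup>2)" unfolding \<epsilon>_def by (intro real_sqrt_le_mono) simp
      also have "\<dots> = \<delta> / (2 * d)" using \<delta>(1) d by simp
      finally have "sqrt \<epsilon> * d \<le> \<delta> / 2" using d by (simp add: field_simps)
      then show ?thesis using \<delta>(1) by simp
    qed
    define T where "T y = (1 / d\<^sup>2) * (norm (y - y1))\<^sup>2" for y
    have T0: "T y \<ge> 0" for y by (simp add: T_def)
    have Tle: "T y < b\<^sup>2 \<longleftrightarrow> y \<in> ball y1 (b * d)" if "b > 0" for y b
    proof -
      have "T y < b\<^sup>2 \<longleftrightarrow> (norm (y - y1))\<^sup>2 < (b * d)\<^sup>2"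
        using d by (simp add: T_def power_mult_distrib field_simps)
      also have "\<dots> \<longleftrightarrow> norm (y - y1) < b * d"
        using that d by (smt (verit, best) mult_pos_pos norm_ge_zero power_less_imp_less_base power_strict_mono zero_less_numeral)
      finally show ?thesis by (simp add: dist_norm norm_minus_commute)
    qed
    define F where "F j t = (deriv ^^ j) h (t + \<epsilon>)" for j t
    have DkF: "Dk_on (2 * m) {- \<epsilon><..} (\<lambda>t. h (t + \<epsilon>))"
    proof -
      have "(\<lambda>x. 1 * x + \<epsilon>) -` {0<..} = {- \<epsilon><..}" by auto
      then show ?thesis using Dk_on_compose_affine[OF _ h(1), of 1 \<epsilon>] by simp
    qed
    have JF: "jets (2 * m) {- \<epsilon><..} F"
      using jets_deriv[OF DkF] unfolding F_def[abs_def] higher_deriv_shift .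
    define \<phi> where "\<phi> y = h (T y + \<epsilon>)" for y
    have \<phi>F: "\<phi> = (\<lambda>y. F 0 ((1 / d\<^sup>2) * (norm (y - y1))\<^sup>2))" by (auto simp: \<phi>_def F_def T_def)
    have TS: "T y \<in> {- \<epsilon><..}" for y using T0[of y] \<epsilon> by simp
    have Ck\<phi>: "Ck_on (2 * m) UNIV \<phi>"
      unfolding \<phi>F by (rule Ck_on_radial[OF open_UNIV JF]) (use TS in \<open>simp add: T_def\<close>)
    have lap: "iter_laplacian m \<phi> y = (rad_op (1 / d\<^sup>2) (real m) ^^ m) F 0 (T y)" for y
      unfolding \<phi>F T_def a[symmetric] by (rule iter_laplacian_radial[OF _ JF]) (use TS in \<open>auto simp: T_def\<close>)
    have ball1: "T y < 1 \<longleftrightarrow> y \<in> ball y1 d" for y using Tle[of 1 y] by simp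
    have \<phi>out: "\<phi> y = 0" if "y \<notin> ball y1 d" for y
      using that ball1[of y] \<epsilon> unfolding \<phi>_def by (intro h(3)) simp
    have \<phi>0: "\<phi> y \<ge> 0" for y unfolding \<phi>_def using T0[of y] \<epsilon> by (intro h(4)) simp
    have \<phi>far: "\<phi> y = 0" if "norm y > norm y1 + d" for y
    proof (rule \<phi>out)
      show "y \<notin> ball y1 d" using that norm_triangle_ineq2[of y y1] by (simp add: dist_norm norm_minus_commute)
    qed
    define bub where "bub y = (4 / d\<^sup>2) ^ m * (fact (2 * m - 1) * \<epsilon> ^ m / (T y + \<epsilon>) ^ (2 * m))" for y
    have lap_inner: "- iter_laplacian m \<phi> y = bub y" if "T y + \<epsilon> < 1/2" for y
    proof -
      have "F j (T y) = (-1) ^ j * fact (j - 1) / (T y + \<epsilon>) ^ j" if "j \<ge> 1" "j \<le> 2 * m" for j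
      proof -
        have "(deriv ^^ j) h (T y + \<epsilon>) = (if j = 0 then - ln (T y + \<epsilon>) else (-1) ^ j * fact (j - 1) / (T y + \<epsilon>) ^ j)"
        proof (rule jets_unique[where S="{0<..<1/2}" and k="2 * m" and F="\<lambda>j. (deriv ^^ j) h"])
          show "jets (2 * m) {0<..<1/2} (\<lambda>j. (deriv ^^ j) h)"
            by (rule jets_subset[OF jets_deriv[OF h(1)]]) auto
          show "jets (2 * m) {0<..<1/2} (\<lambda>j s. if j = 0 then - ln s else (-1) ^ j * fact (j - 1) / s ^ j :: real)"
            by (rule jets_subset[OF jets_minus_log]) auto
        qed (use h(2) that T0[of y] \<epsilon> \<open>T y + \<epsilon> < 1/2\<close> in auto)
        then show ?thesis using that by (simp add: F_def)
      qed
      note Fj = this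
      \<comment> \<open>\<open>rad_op_log\<close> asks for the formula at every order, but
        \<open>h\<close> has only \<open>2 * m\<close> controlled derivatives. The higher orders may
        be redefined, as the operator does not read them.\<close>
      define F' where "F' j t = (if j \<le> 2 * m then F j t else (-1) ^ j * fact (j - 1) / (t + \<epsilon>) ^ j)" for j t
      have "(rad_op (1 / d\<^sup>2) (real m) ^^ m) F 0 (T y) = (rad_op (1 / d\<^sup>2) (real m) ^^ m) F' 0 (T y)"
        unfolding rad_op_funpow F'_def by simp
      also have "\<dots> = (4 * (1 / d\<^sup>2)) ^ m * ((-1) ^ m * fact (2 * m - 1) * \<epsilon> ^ m / (T y + \<epsilon>) ^ (2 * m))"
        by (rule rad_op_log[OF m1]) (use T0[of y] \<epsilon> Fj in \<open>auto simp: F'_def\<close>)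
      finally show ?thesis unfolding lap bub_def using m by simp
    qed
    have lap_mid: "- iter_laplacian m \<phi> y \<ge> - (C / d ^ (2 * m))" if "1/2 \<le> T y + \<epsilon>" "T y + \<epsilon> \<le> 1" for y
    proof -
      have "\<bar>(rad_op (1 / d\<^sup>2) (real m) ^^ m) F 0 (T y)\<bar> \<le> (4 * (1 / d\<^sup>2)) ^ m * B"
        unfolding F_def by (rule B(2)) (use that T0[of y] \<epsilon> in auto)
      moreover have "(4 * (1 / d\<^sup>2)) ^ m * B = C / d ^ (2 * m)"
        by (simp add: C_def power_divide power_mult)
      ultimately show ?thesis unfolding lap by linarith
    qed
    have lap_outer: "iter_laplacian m \<phi> y = 0" if "1 < T y + \<epsilon>" for y
    proof -
      have "open {y. 1 < T y + \<epsilon>}" unfolding T_def by (intro open_Collect_less continuous_intros)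
      then have "iter_laplacian m \<phi> y = iter_laplacian m (\<lambda>_. 0) y"
        by (rule iter_laplacian_cong) (use that h(3) in \<open>auto simp: \<phi>_def\<close>)
      then show ?thesis by simp
    qed
    define \<kappa> where "\<kappa> = (4 / d\<^sup>2) ^ m * fact (2 * m - 1) / (4 ^ m * \<epsilon> ^ m) * (V y1 / 2)"
    have \<kappa>0: "\<kappa> \<ge> 0" using V(2)[of y1] \<epsilon> by (simp add: \<kappa>_def)
    have C0: "C \<ge> 0" using B by (simp add: C_def)
    have Cd: "C / d ^ (2 * m) \<ge> 0" using C0 d by simp
    \<comment> \<open>Four zones: the core carries the bubble, the rest of the inner zone
      contributes a nonnegative amount, the transition zone loses at most
      \<open>C / d ^ (2 * m)\<close> times \<open>V\<close>, and beyond it the test function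
      vanishes.\<close>
    have pointwise: "\<kappa> * indicator (ball y1 (sqrt \<epsilon> * d)) y - C / d ^ (2 * m) * (indicator (ball y1 d) y * V y)
      \<le> V y * - iter_laplacian m \<phi> y" for y
    proof -
      have se2: "(sqrt \<epsilon>)\<^sup>2 = \<epsilon>" using \<epsilon> by simp
      have inn: "y \<in> ball y1 (sqrt \<epsilon> * d) \<longleftrightarrow> T y < \<epsilon>" using Tle[of "sqrt \<epsilon>" y] \<epsilon> se2 by simp
      consider "T y < \<epsilon>" | "\<epsilon> \<le> T y" "T y + \<epsilon> < 1/2" | "1/2 \<le> T y + \<epsilon>" "T y + \<epsilon> \<le> 1" | "1 < T y + \<epsilon>" by linarith
      then show ?thesis
      proof cases
        case 1
        have "bub y \<ge> (4 / d\<^sup>2) ^ m * (fact (2 * m - 1) * (1 / (4 ^ m * \<epsilon> ^ m)))"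
          unfolding bub_def times_divide_eq_right[symmetric, of "fact _"]
          by (intro mult_left_mono bubble_lower_bound T0 1) auto
        moreover have "dist y y1 < \<delta>" using 1 inn se by (simp add: dist_commute)
        then have "V y \<ge> V y1 / 2" by (rule \<delta>(2))
        moreover have "(4 / d\<^sup>2) ^ m * (fact (2 * m - 1) * (1 / (4 ^ m * \<epsilon> ^ m))) \<ge> (0::real)" using \<epsilon> by simp
        ultimately have "(V y1 / 2) * ((4 / d\<^sup>2) ^ m * (fact (2 * m - 1) * (1 / (4 ^ m * \<epsilon> ^ m)))) \<le> V y * bub y"
          using V(2)[of y] by (intro mult_mono) auto
        then have "\<kappa> \<le> V y * bub y" by (simp add: \<kappa>_def mult_ac)
        moreover have "C / d ^ (2 * m) * (indicator (ball y1 d) y * V y) \<ge> 0" using Cd V(2)[of y] by (intro mult_nonneg_nonneg) auto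
        ultimately show ?thesis using 1 inn \<epsilon> by (simp add: lap_inner)
      next
        case 2
        have "bub y \<ge> 0" unfolding bub_def using T0[of y] \<epsilon> by simp
        then have "V y * - iter_laplacian m \<phi> y \<ge> 0" using 2 V(2)[of y] by (simp add: lap_inner)
        moreover have "C / d ^ (2 * m) * (indicator (ball y1 d) y * V y) \<ge> 0" using Cd V(2)[of y] by (intro mult_nonneg_nonneg) auto
        moreover have "y \<notin> ball y1 (sqrt \<epsilon> * d)" using 2 inn by simp
        ultimately show ?thesis by simp
      next
        case 3
        have "V y * - iter_laplacian m \<phi> y \<ge> V y * - (C / d ^ (2 * m))"
          using lap_mid[OF 3] V(2)[of y] by (intro mult_left_mono)
        moreover have "y \<in> ball y1 d" using 3 \<epsilon> ball1[of y] by simp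
        moreover have "y \<notin> ball y1 (sqrt \<epsilon> * d)" using 3 \<epsilon> inn by simp
        ultimately show ?thesis by (simp add: mult.commute)
      next
        case 4
        moreover have "C / d ^ (2 * m) * (indicator (ball y1 d) y * V y) \<ge> 0" using Cd V(2)[of y] by (intro mult_nonneg_nonneg) auto
        moreover have "y \<notin> ball y1 (sqrt \<epsilon> * d)" using 4 \<epsilon> inn by simp
        ultimately show ?thesis by (simp add: lap_outer)
      qed
    qed
    have cont_lap: "continuous_on UNIV (iter_laplacian m \<phi>)"
      using Ck_on_iter_laplacian[OF open_UNIV, of 0 m \<phi>] Ck\<phi> by simp
    have intV: "integrable lborel (\<lambda>y. indicator (ball y1 d) y * V y)"
      by (intro integrable_indicator_continuous contV) auto
    have intg: "integrable lborel (\<lambda>y. indicator (ball y1 d) y * g y)"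
      by (intro integrable_indicator_continuous contg) auto
    have int1: "integrable lborel (\<lambda>y. V y * - iter_laplacian m \<phi> y)"
      by (rule integrable_compact_support[where R="norm y1 + d"])
         (use \<phi>far in \<open>auto intro!: continuous_intros contV cont_lap simp: vanishing_outside_iter_laplacian[OF \<phi>far]\<close>)
    have int2: "integrable lborel (\<lambda>y. g y * \<phi> y)"
      by (rule integrable_compact_support[where R="norm y1 + d"])
         (use \<phi>far in \<open>auto intro!: continuous_intros contg Ck_on_imp_continuous_on[OF Ck\<phi>]\<close>)
    have "(\<integral>y. \<kappa> * indicator (ball y1 (sqrt \<epsilon> * d)) y - C / d ^ (2 * m) * (indicator (ball y1 d) y * V y) \<partial>lborel)
      \<le> (\<integral>y. V y * - iter_laplacian m \<phi> y \<partial>lborel)"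
      using \<epsilon> d by (intro integral_mono int1 pointwise Bochner_Integration.integrable_diff
        integrable_mult_right intV integral_indicator_ball) auto
    also have "(\<integral>y. \<kappa> * indicator (ball y1 (sqrt \<epsilon> * d)) y - C / d ^ (2 * m) * (indicator (ball y1 d) y * V y) \<partial>lborel)
      = \<kappa> * (\<omega> * (sqrt \<epsilon> * d) ^ (2 * m)) - C / d ^ (2 * m) * (\<integral>y. indicator (ball y1 d) y * V y \<partial>lborel)"
      using \<epsilon> d integral_indicator_ball[of "sqrt \<epsilon> * d" y1] intV dim by (simp add: \<omega>_def)
    also have "\<kappa> * (\<omega> * (sqrt \<epsilon> * d) ^ (2 * m)) = c * V y1"
    proof -
      have "(sqrt \<epsilon> * d) ^ (2 * m) = \<epsilon> ^ m * d ^ (2 * m)"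
        using \<epsilon> by (simp add: power_mult_distrib power_mult)
      moreover have "(4 / d\<^sup>2) ^ m = 4 ^ m / d ^ (2 * m)" by (simp add: power_divide power_mult)
      ultimately show ?thesis using \<epsilon> d by (simp add: \<kappa>_def c_def field_simps)
    qed
    also have "(\<integral>y. V y * - iter_laplacian m \<phi> y \<partial>lborel) = (\<integral>y. g y * \<phi> y \<partial>lborel)"
      using integral_iter_laplacian_swap[OF V(1) Ck\<phi> \<phi>far] by (simp add: g_def)
    finally have lower: "c * V y1 - C / d ^ (2 * m) * (\<integral>y. indicator (ball y1 d) y * V y \<partial>lborel) \<le> (\<integral>y. g y * \<phi> y \<partial>lborel)" .
    \<comment> \<open>The number of layers depends on \<epsilon>, hence on \<open>V\<close>; the
      geometric sum below removes this dependence.\<close>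
    obtain K where K: "ln (\<rho>\<^sup>2 / (\<epsilon> * d\<^sup>2)) / 2 \<le> real K" using real_arch_simple by blast
    have L0: "ln (d\<^sup>2 / \<rho>\<^sup>2) \<ge> 0" using \<rho> d by (simp add: power_mono)
    \<comment> \<open>The kernel is split at scale \<rho> into a constant, integrated against the
      mass of \<open>g\<close>, and a local singularity in layers, for which
      \<open>g y \<le> \<Gamma>\<close> is used.\<close>
    have \<phi>up: "\<phi> y \<le> ln (d\<^sup>2 / \<rho>\<^sup>2) + 2 * (\<Sum>k<K. indicator (ball y1 (\<rho> * exp (- real k))) y)" for y
    proof (cases "T y + \<epsilon> \<le> 1")
      case True
      define r where "r = norm (y - y1)"
      have Te: "T y + \<epsilon> = (r\<^sup>2 + \<epsilon> * d\<^sup>2) / d\<^sup>2" using d by (simp add: T_def r_def field_simps)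
      have re: "r\<^sup>2 + \<epsilon> * d\<^sup>2 > 0" using \<epsilon> d by (intro add_nonneg_pos) auto
      have "\<phi> y \<le> - ln (T y + \<epsilon>)" unfolding \<phi>_def using True T0[of y] \<epsilon> by (intro h(5)) auto
      also have "\<dots> = ln (d\<^sup>2 / \<rho>\<^sup>2) + ln (\<rho>\<^sup>2 / (r\<^sup>2 + \<epsilon> * d\<^sup>2))"
        unfolding Te using re \<rho> d by (simp add: ln_div)
      also have "ln (\<rho>\<^sup>2 / (r\<^sup>2 + \<epsilon> * d\<^sup>2)) \<le> 2 * (\<Sum>k<K. if r < \<rho> * exp (- real k) then 1 else 0)"
        using \<rho> \<epsilon> d K by (intro ln_le_sum_indicators) (auto simp: r_def)
      also have "(\<Sum>k<K. if r < \<rho> * exp (- real k) then 1 else 0) = (\<Sum>k<K. indicator (ball y1 (\<rho> * exp (- real k))) y :: real)"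
        by (intro sum.cong refl) (auto simp: r_def indicator_def dist_norm norm_minus_commute)
      finally show ?thesis by simp
    next
      case False
      then have "\<phi> y = 0" unfolding \<phi>_def by (intro h(3)) simp
      then show ?thesis using L0 by (simp add: sum_nonneg)
    qed
    have "(\<integral>y. g y * \<phi> y \<partial>lborel) \<le> (\<integral>y. ln (d\<^sup>2 / \<rho>\<^sup>2) * (indicator (ball y1 d) y * g y)
       + 2 * \<Gamma> * (\<Sum>k<K. indicator (ball y1 (\<rho> * exp (- real k))) y) \<partial>lborel)"
    proof (intro integral_mono int2 Bochner_Integration.integrable_add integrable_mult_right intg Bochner_Integration.integrable_sum integral_indicator_ball)
      fix y
      define s where "s = (\<Sum>k<K. indicator (ball y1 (\<rho> * exp (- real k))) y :: real)"
      have s: "s \<ge> 0" unfolding s_def by (intro sum_nonneg) auto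
      show "g y * \<phi> y \<le> ln (d\<^sup>2 / \<rho>\<^sup>2) * (indicator (ball y1 d) y * g y) + 2 * \<Gamma> * s"
      proof (cases "y \<in> ball y1 d")
        case True
        have "g y * \<phi> y \<le> g y * (ln (d\<^sup>2 / \<rho>\<^sup>2) + 2 * s)"
          using g0[OF True] \<phi>up[of y] unfolding s_def by (intro mult_left_mono)
        also have "\<dots> \<le> ln (d\<^sup>2 / \<rho>\<^sup>2) * g y + 2 * \<Gamma> * s"
          using mult_right_mono[OF g0(2)[OF True] s] by (simp add: algebra_simps)
        finally show ?thesis using True by simp
      next
        case False
        then show ?thesis using \<phi>out[OF False] s \<Gamma> by simp
      qed
    qed (use \<rho> in auto)
    also have "\<dots> = ln (d\<^sup>2 / \<rho>\<^sup>2) * (\<integral>y. indicator (ball y1 d) y * g y \<partial>lborel)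
       + 2 * \<Gamma> * (\<Sum>k<K. \<omega> * (\<rho> * exp (- real k)) ^ (2 * m))"
    proof -
      have i: "integrable lborel (indicator (ball y1 (\<rho> * exp (- real k))) :: _ \<Rightarrow> real)"
        "(\<integral>y. indicator (ball y1 (\<rho> * exp (- real k))) y \<partial>lborel) = \<omega> * (\<rho> * exp (- real k)) ^ (2 * m)" for k
        using integral_indicator_ball[of "\<rho> * exp (- real k)" y1] \<rho> dim by (auto simp: \<omega>_def)
      then have "integrable lborel (\<lambda>y. \<Sum>k<K. indicator (ball y1 (\<rho> * exp (- real k))) y :: real)"
        by (intro Bochner_Integration.integrable_sum)
      then show ?thesis using intg i by (simp add: Bochner_Integration.integral_sum)
    qed
    also have "2 * \<Gamma> * (\<Sum>k<K. \<omega> * (\<rho> * exp (- real k)) ^ (2 * m)) = 2 * \<Gamma> * (\<omega> * \<rho> ^ (2 * m)) * (\<Sum>k<K. exp (- real k) ^ (2 * m))"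
      by (simp add: power_mult_distrib sum_distrib_left algebra_simps)
    also have "\<dots> \<le> 2 * \<Gamma> * (\<omega> * \<rho> ^ (2 * m)) * 2"
      using \<Gamma> \<omega> \<rho> m1 by (intro mult_left_mono sum_exp_power_le) auto
    finally show ?thesis using lower by (simp add: g_def algebra_simps)
  qed
  moreover have "c > 0" "C \<ge> 0" using \<omega> B by (auto simp: c_def C_def)
  ultimately show ?thesis unfolding \<omega>_def by (intro that[of c C]) blast+
qed

section \<open>Growth of integrals\<close>

text \<open>As \<open>t\<close> is a squared distance, \<open>1 / t ^ (m - 1)\<close> is the
  Newtonian profile \<open>|y| ^ (2 - n)\<close> with \<open>n = 2 * m\<close>. The exponent
  \<open>2 * m + 1\<close> lets \<open>2 * m - 1\<close> derivatives of \<open>t ^ m * F'\<close>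
  end in a multiple of a square, continuous and nonnegative.\<close>

lemma ex_truncated_fundamental:
  assumes m: "m \<ge> 2"
  obtains F :: "real \<Rightarrow> real" and c :: real
  where "\<And>t. 0 < t \<Longrightarrow> (F has_real_derivative - (max 0 (1 - t) ^ (2 * m + 1) / t ^ m)) (at t)"
    "\<And>t. 0 < t \<Longrightarrow> 0 \<le> F t" "\<And>t. 0 < t \<Longrightarrow> t \<le> 1 \<Longrightarrow> F t \<le> 1 / t ^ (m - 1)"
    "\<And>t. 1 \<le> t \<Longrightarrow> F t = 0" "c > 0" "\<And>t. 0 < t \<Longrightarrow> t \<le> 1/4 \<Longrightarrow> c / t ^ (m - 1) \<le> F t"
proof -
  define g :: "real \<Rightarrow> real" where "g t = max 0 (1 - t) ^ (2 * m + 1) / t ^ m" for t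
  \<comment> \<open>The upper limit 2 lies beyond the support, away from the junction at 1.\<close>
  define F :: "real \<Rightarrow> real" where "F t = (if t < 2 then integral {t..2} g else 0)" for t
  have g0: "g t \<ge> 0" if "t > 0" for t using that by (simp add: g_def)
  have gz: "g t = 0" if "t \<ge> 1" for t using that by (simp add: g_def max_def)
  have contg: "continuous_on {a..2} g" if "a > 0" for a
    unfolding g_def using that by (intro continuous_intros) auto
  have Fz: "F t = 0" if "1 \<le> t" for t
  proof -
    have "integral {t..2} g = integral {t..2} (\<lambda>_. 0)" using that by (intro integral_cong) (auto intro: gz)
    then show ?thesis by (simp add: F_def)
  qed
  have der: "(F has_real_derivative - g t) (at t)" if "0 < t" for t
  proof (cases "t < 2")
    case True
    define a where "a = t / 2"
    have a: "0 < a" "a < t" using that by (auto simp: a_def)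
    have "((\<lambda>x. integral {a..x} g) has_real_derivative g t) (at t within {a..2})"
      using contg[OF a(1)] a True by (intro integral_has_real_derivative) auto
    then have "((\<lambda>x. integral {a..x} g) has_real_derivative g t) (at t)"
      using a True by (simp add: at_within_interior[of t "{a..2}"])
    then have "((\<lambda>x. integral {a..2} g - integral {a..x} g) has_real_derivative 0 - g t) (at t)"
      by (intro DERIV_diff DERIV_const)
    then have "(F has_real_derivative 0 - g t) (at t)"
    proof (rule has_field_derivative_transform_within_open[of _ _ _ "{a<..<2}"])
      fix x assume x: "x \<in> {a<..<2}"
      have "integral {a..x} g + integral {x..2} g = integral {a..2} g"
        using x contg[OF a(1)] by (intro Henstock_Kurzweil_Integration.integral_combine integrable_continuous_real) auto
      then show "integral {a..2} g - integral {a..x} g = F x" using x by (simp add: F_def)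
    qed (use a True in auto)
    then show ?thesis by simp
  next
    case False
    have "((\<lambda>_. 0) has_real_derivative - g t) (at t)" using False by (simp add: gz)
    then show ?thesis
      by (rule has_field_derivative_transform_within_open[of _ _ _ "{1<..}"]) (use False Fz in auto)
  qed
  have F0: "F t \<ge> 0" if "0 < t" for t
  proof (cases "t \<le> 1")
    case True
    have "F 1 \<le> F t"
    proof (rule DERIV_nonpos_imp_nonincreasing[OF True])
      fix s assume "t \<le> s"
      then have "s > 0" using that by simp
      then show "\<exists>y. (F has_real_derivative y) (at s) \<and> y \<le> 0"
        using der[of s] g0[of s] by (intro exI[of _ "- g s"]) simp
    qed
    then show ?thesis using Fz[of 1] by simp
  qed (simp add: Fz)
  obtain q where q: "m = Suc q" "q \<ge> 1" using m by (cases m) auto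
  have Fup: "F t \<le> 1 / t ^ (m - 1)" if "0 < t" "t \<le> 1" for t
  proof -
    \<comment> \<open>\<open>H\<close> compares \<open>F\<close> with the primitive obtained when
      the numerator is replaced by its bound 1; so \<open>H\<close> is nonincreasing, and it is
      nonnegative at 1.\<close>
    define H where "H t = inverse (t ^ q) / real q - F t" for t
    have dH: "(H has_real_derivative g s - 1 / s ^ m) (at s)" if "s > 0" for s
    proof -
      have "((\<lambda>t. inverse (t ^ q) / real q) has_real_derivative - (inverse (s ^ q) * (real q * s ^ (q - 1)) * inverse (s ^ q)) / real q) (at s)"
        using that by (auto intro!: derivative_eq_intros)
      also have "- (inverse (s ^ q) * (real q * s ^ (q - 1)) * inverse (s ^ q)) / real q = - 1 / s ^ m"
        using that q by (cases q) (simp_all add: field_simps del: of_nat_Suc)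
      finally show ?thesis unfolding H_def using DERIV_diff[OF _ der[OF that]] by fastforce
    qed
    have "H 1 \<le> H t"
    proof (rule DERIV_nonpos_imp_nonincreasing[OF \<open>t \<le> 1\<close>])
      fix s assume s: "t \<le> s" "s \<le> 1"
      then have "max 0 (1 - s) ^ (2 * m + 1) \<le> 1" using that by (intro power_le_one) auto
      then have "g s \<le> 1 / s ^ m" unfolding g_def using s that by (intro divide_right_mono) auto
      then show "\<exists>y. (H has_real_derivative y) (at s) \<and> y \<le> 0" using dH[of s] s that by force
    qed
    then have "F t \<le> inverse (t ^ q) / real q" using Fz[of 1] by (simp add: H_def) (smt (verit) of_nat_0_le_iff divide_nonneg_nonneg)
    also have "\<dots> \<le> inverse (t ^ q)" using q that by (simp add: field_simps)
    finally show ?thesis using q by (simp add: inverse_eq_divide)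
  qed
  define c :: real where "c = (1/2) ^ (2 * m + 1) / 2 ^ m"
  have Flow: "c / t ^ (m - 1) \<le> F t" if "0 < t" "t \<le> 1/4" for t
  proof -
    \<comment> \<open>One mean value step suffices: up to \<open>2 * t \<le> 1/2\<close> the
      numerator is at least a fixed power of 1/2, and \<open>F\<close> is nonnegative at
      \<open>2 * t\<close>.\<close>
    have "\<exists>z>t. z < 2 * t \<and> F (2 * t) - F t = (2 * t - t) * (- g z)"
      by (rule MVT2) (use der that in auto)
    then obtain z where z: "t < z" "z < 2 * t" "F (2 * t) - F t = (2 * t - t) * (- g z)" by blast
    have "(1/2) ^ (2 * m + 1) \<le> max 0 (1 - z) ^ (2 * m + 1)" using z that by (intro power_mono) auto
    moreover have "z ^ m \<le> (2 * t) ^ m" using z that by (intro power_mono) auto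
    ultimately have "(1/2) ^ (2 * m + 1) / (2 * t) ^ m \<le> g z" unfolding g_def
      using z that by (intro frac_le) auto
    then have "t * ((1/2) ^ (2 * m + 1) / (2 * t) ^ m) \<le> t * g z" using that by (intro mult_left_mono) auto
    also have "\<dots> \<le> F t" using z(3) F0[of "2 * t"] that by (simp add: algebra_simps)
    also have "t * ((1/2) ^ (2 * m + 1) / (2 * t) ^ m) = c / t ^ (m - 1)"
      using that q by (simp add: c_def power_mult_distrib field_simps)
    finally show ?thesis .
  qed
  have "c > 0" by (simp add: c_def)
  with der F0 Fup Fz Flow show ?thesis unfolding g_def by (intro that[of F c]) auto
qed

lemma DERIV_pos_part_power_reflected:
  assumes "p \<ge> 2"
  shows "((\<lambda>t::real. max 0 (1 - t) ^ p) has_real_derivative - (real p * max 0 (1 - t) ^ (p - 1))) (at t)"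
proof -
  obtain q where q: "p = Suc (Suc q)" using assms by (metis add_2_eq_Suc le_Suc_ex)
  have "((\<lambda>t. 1 - t) has_real_derivative -1) (at t)" by (auto intro!: derivative_eq_intros)
  from DERIV_chain2[OF DERIV_pos_part_power this] show ?thesis by (simp add: q)
qed

lemma jets_pos_part_power_reflected:
  "jets (2 * m - 1) UNIV (\<lambda>j t. - ((-1) ^ j * (fact (2 * m + 1) / fact (2 * m + 1 - j)) * max 0 (1 - t) ^ (2 * m + 1 - j)))"
proof (rule jetsI)
  fix j and t :: real assume j: "j < 2 * m - 1"
  define p where "p = 2 * m + 1 - j"
  have p: "p \<ge> 2" "2 * m + 1 - Suc j = p - 1" using j by (auto simp: p_def)
  have f: "(fact p :: real) = real p * fact (p - 1)" using p by (cases p) auto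
  have "((\<lambda>t. - ((-1) ^ j * (fact (2 * m + 1) / fact p) * max 0 (1 - t) ^ p)) has_real_derivative
     - ((-1) ^ j * (fact (2 * m + 1) / fact p) * - (real p * max 0 (1 - t) ^ (p - 1)))) (at t)"
    by (intro DERIV_minus DERIV_cmult DERIV_pos_part_power_reflected p)
  also have "- ((-1) ^ j * (fact (2 * m + 1) / fact p) * - (real p * max 0 (1 - t) ^ (p - 1)))
    = - ((-1) ^ Suc j * (fact (2 * m + 1) / fact (p - 1)) * max 0 (1 - t) ^ (p - 1))"
    using p unfolding f by (simp add: field_simps)
  finally show "((\<lambda>t. - ((-1) ^ j * (fact (2 * m + 1) / fact (2 * m + 1 - j)) * max 0 (1 - t) ^ (2 * m + 1 - j))) has_real_derivative
     - ((-1) ^ Suc j * (fact (2 * m + 1) / fact (2 * m + 1 - Suc j)) * max 0 (1 - t) ^ (2 * m + 1 - Suc j))) (at t)"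
    unfolding p(2) p_def[symmetric] .
qed (intro continuous_intros)

text \<open>The test function \<open>F (|y|\<^sup>2 / R\<^sup>2)\<close> with \<open>t ^ m * F' = - (1 - t)\<^sub>+ ^ (2 * m + 1)\<close> has a nonnegative
  polyharmonic image and behaves like \<open>(R / |y|) ^ (2 * m - 2)\<close> near the origin; the singularity
  there is cut off, which is harmless because \<open>V\<close> vanishes.\<close>

lemma growth_bound:
  fixes V :: "real^'n::finite \<Rightarrow> real"
  assumes dim: "CARD('n) = 2 * m" and m: "m \<ge> 2"
    and V: "Ck_on (2 * m) UNIV V" "\<And>y. V y \<ge> 0" "\<And>y. (norm y)\<^sup>2 < 1/2 \<Longrightarrow> V y = 0"
    and G: "\<And>y. norm y > 1 \<Longrightarrow> 0 \<le> - iter_laplacian m V y"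
  obtains C where "\<And>R. R \<ge> 2 \<Longrightarrow> (\<integral>y. indicator (ball 0 (R / 2)) y * V y \<partial>lborel) \<le> C * R ^ (4 * m - 2)"
    "\<And>R. R \<ge> 2 \<Longrightarrow> (\<integral>y. indicator {y. 1 < norm y \<and> norm y < R / 2} y * (- iter_laplacian m V y / norm y ^ (2 * m - 2)) \<partial>lborel) \<le> C"
proof -
  have m1: "m \<ge> 1" using m by simp
  have a: "real CARD('n) / 2 = real m" using dim by simp
  have contV: "continuous_on UNIV V" using V(1) by (rule Ck_on_imp_continuous_on)
  define g where "g y = - iter_laplacian m V y" for y
  have contg: "continuous_on UNIV g" unfolding g_def
    using Ck_on_iter_laplacian[OF open_UNIV, of 0 m V] V(1) by (simp add: continuous_on_minus)
  have gin: "g y = 0" if "(norm y)\<^sup>2 < 1/2" for y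
  proof -
    have "open {y::real^'n. (norm y)\<^sup>2 < 1/2}" by (intro open_Collect_less continuous_intros)
    then have "iter_laplacian m V y = iter_laplacian m (\<lambda>_. 0) y"
      by (rule iter_laplacian_cong) (use that V(3) in auto)
    then show ?thesis by (simp add: g_def)
  qed
  have "compact (g ` cball 0 1)" by (intro compact_continuous_image continuous_on_subset[OF contg]) auto
  then obtain G0 where "\<forall>z\<in>g ` cball 0 1. norm z \<le> G0"
    by (blast dest: compact_imp_bounded[THEN bounded_iff[THEN iffD1]])
  then have G0: "\<bar>g y\<bar> \<le> G0" if "norm y \<le> 1" for y using that by simp
  have G00: "G0 \<ge> 0" using G0[of 0] by simp
  obtain F cF where F: "\<And>t. 0 < t \<Longrightarrow> (F has_real_derivative - (max 0 (1 - t) ^ (2 * m + 1) / t ^ m)) (at t)"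
    "\<And>t. 0 < t \<Longrightarrow> 0 \<le> F t" "\<And>t. 0 < t \<Longrightarrow> t \<le> 1 \<Longrightarrow> F t \<le> 1 / t ^ (m - 1)"
    "\<And>t. 1 \<le> t \<Longrightarrow> F t = 0" "cF > 0" "\<And>t. 0 < t \<Longrightarrow> t \<le> 1/4 \<Longrightarrow> cF / t ^ (m - 1) \<le> F t"
    by (rule ex_truncated_fundamental[OF m]) blast
  have DkF: "Dk_on (2 * m) {0<..} F"
  proof -
    have "Dk_on (2 * m) UNIV (\<lambda>t. max 0 (-1 * t + 1) ^ Suc (2 * m))"
      using Dk_on_compose_affine[OF open_UNIV Dk_on_pos_part_power[of "2 * m"], of "-1" 1] by simp
    then have "Dk_on (2 * m - 1) {0<..} (\<lambda>t. max 0 (-1 * t + 1) ^ Suc (2 * m))"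
      by (rule Dk_on_subset[OF Dk_on_mono]) auto
    moreover have "Dk_on (2 * m - 1) {0<..} (\<lambda>t. inverse (t ^ m))"
      by (intro Dk_on_inverse Dk_on_power Dk_on_ident) auto
    ultimately have "Dk_on (2 * m - 1) {0<..} (\<lambda>t. (-1) * (max 0 (-1 * t + 1) ^ Suc (2 * m) * inverse (t ^ m)))"
      by (intro Dk_on_mult[OF open_greaterThan] Dk_on_const open_greaterThan)
    then have "Dk_on (Suc (2 * m - 1)) {0<..} F"
      by (intro Dk_on_SucI[of _ F "\<lambda>t. (-1) * (max 0 (-1 * t + 1) ^ Suc (2 * m) * inverse (t ^ m))"])
         (use F(1) in \<open>auto simp: divide_inverse simp del: power_Suc\<close>)
    then show ?thesis using m1 by simp
  qed
  \<comment> \<open>The cutoff acts on \<open>|y|\<^sup>2\<close> between 1/4 and 1/3, strictly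
    inside the region below 1/2 where \<open>V\<close> and \<open>g\<close> vanish, so the modified
    part is never seen.\<close>
  obtain \<eta> :: "real \<Rightarrow> real" where \<eta>: "Dk_on (2 * m) UNIV \<eta>" "\<And>t. t \<le> 1/4 \<Longrightarrow> \<eta> t = 0" "\<And>t. 1/3 \<le> t \<Longrightarrow> \<eta> t = 1"
    "\<And>t. 0 \<le> \<eta> t" by (rule ex_cutoff[of "1/4" "1/3" "2 * m"]) auto
  define E where "E j t = - ((-1) ^ j * (fact (2 * m + 1) / fact (2 * m + 1 - j)) * max 0 (1 - t) ^ (2 * m + 1 - j))" for j and t :: real
  have JE: "jets (2 * m - 1) UNIV E" unfolding E_def[abs_def] by (rule jets_pos_part_power_reflected)
  define e where "e = (fact (2 * m + 1) / 2 :: real)"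
  have e: "e > 0" by (simp add: e_def)
  have Etop: "E (2 * m - 1) t = e * (max 0 (1 - t))\<^sup>2" for t
  proof -
    have "2 * m + 1 - (2 * m - 1) = 2" "odd (2 * m - 1)" using m1 by auto
    then show ?thesis by (simp add: E_def e_def)
  qed
  \<comment> \<open>The factor 9/16 is \<open>(1 - 1/4)\<^sup>2\<close>: the scaled variable is at
    most 1/4 on the ball of radius \<open>R / 2\<close>.\<close>
  define \<kappa> where "\<kappa> = 4 ^ m * e * (9/16)"
  have \<kappa>: "\<kappa> > 0" using e by (simp add: \<kappa>_def)
  define \<omega> where "\<omega> = (\<integral>y. (indicator (cball 0 1) y :: real) \<partial>(lborel :: (real^'n) measure))"
  have \<omega>: "\<omega> \<ge> 0" unfolding \<omega>_def by (rule integral_nonneg_AE) auto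
  \<comment> \<open>Worst case on the unit ball, where \<open>g\<close> has no sign:
    \<open>g\<close> is bounded by \<open>G0\<close>, and where it can be nonzero the test function
    is at most \<open>2 ^ (m - 1) * R ^ (2 * m - 2)\<close>.\<close>
  define C1 where "C1 = G0 * 2 ^ (m - 1) * \<omega>"
  have C1: "C1 \<ge> 0" using G00 \<omega> by (simp add: C1_def)
  \<comment> \<open>The integrals of \<open>V * \<Delta> ^ m \<phi>\<close> and
    \<open>g * \<phi>\<close> are opposite. Both integrands are nonnegative outside the unit ball,
    so the two quantities together are controlled by what \<open>g\<close> contributes inside
    it.\<close>
  have main: "\<kappa> / R ^ (2 * m) * (\<integral>y. indicator (ball 0 (R / 2)) y * V y \<partial>lborel)
     + cF * R ^ (2 * m - 2) * (\<integral>y. indicator {y. 1 < norm y \<and> norm y < R / 2} y * (g y / norm y ^ (2 * m - 2)) \<partial>lborel)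
     \<le> C1 * R ^ (2 * m - 2)" if R: "R \<ge> 2" for R
  proof -
    have R0: "R > 0" using R by simp
    define T where "T y = (1 / R\<^sup>2) * (norm (y - 0 :: real^'n))\<^sup>2" for y
    have T: "T y = (norm y)\<^sup>2 / R\<^sup>2" for y by (simp add: T_def)
    define Ft where "Ft t = \<eta> (R\<^sup>2 * t + 0) * F t" for t
    have DkFt: "Dk_on (2 * m) UNIV Ft"
    proof -
      have "Dk_on (2 * m) UNIV (\<lambda>t. \<eta> (R\<^sup>2 * t + 0))"
        using Dk_on_compose_affine[OF open_UNIV \<eta>(1), of "R\<^sup>2" 0] by simp
      then have 1: "Dk_on (2 * m) {0<..} Ft" unfolding Ft_def
        by (intro Dk_on_mult DkF) (auto intro: Dk_on_subset)
      have 2: "Dk_on (2 * m) {..<1 / (4 * R\<^sup>2)} Ft"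
        by (rule Dk_on_cong[OF _ _ Dk_on_const[of _ _ 0]])
           (use R0 in \<open>auto simp: Ft_def field_simps intro!: \<eta>(2)\<close>)
      have "1 / (4 * R\<^sup>2) > 0" using R0 by simp
      then have "{0<..} \<union> {..<1 / (4 * R\<^sup>2)} = (UNIV :: real set)" by (auto simp: not_less intro: le_less_trans)
      then show ?thesis using Dk_on_Un[OF _ _ 1 2] by simp
    qed
    define J where "J j = (deriv ^^ j) Ft" for j
    have JJ: "jets (2 * m) UNIV J" unfolding J_def by (rule jets_deriv[OF DkFt])
    define S where "S = {1 / (3 * R\<^sup>2)<..}"
    have S0: "t > 0" if "t \<in> S" for t using that R0 unfolding S_def by (auto intro: less_trans[rotated])
    have FtF: "Ft t = F t" if "t \<in> S" for t
      using that R0 \<eta>(3)[of "R\<^sup>2 * t"] by (simp add: Ft_def S_def field_simps)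
    have JE1: "t ^ m * J 1 t = E 0 t" if t: "t \<in> S" for t
    proof -
      have "(Ft has_real_derivative - (max 0 (1 - t) ^ (2 * m + 1) / t ^ m)) (at t)"
        by (rule has_field_derivative_transform_within_open[OF F(1)[OF S0[OF t]], of S])
           (use t FtF in \<open>auto simp: S_def\<close>)
      then have "J 1 t = - (max 0 (1 - t) ^ (2 * m + 1) / t ^ m)" by (simp add: J_def DERIV_imp_deriv)
      then show ?thesis using S0[OF t] by (simp add: E_def)
    qed
    define \<phi> where "\<phi> y = Ft (T y)" for y
    have \<phi>J: "\<phi> = (\<lambda>y. J 0 ((1 / R\<^sup>2) * (norm (y - 0))\<^sup>2))" by (auto simp: \<phi>_def J_def T_def)
    have Ck\<phi>: "Ck_on (2 * m) UNIV \<phi>" unfolding \<phi>J by (rule Ck_on_radial[OF open_UNIV JJ]) simp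
    have lap: "iter_laplacian m \<phi> y = (4 / R\<^sup>2) ^ m * (e * (max 0 (1 - T y))\<^sup>2)" if "T y \<in> S" for y
    proof -
      have "iter_laplacian m \<phi> y = (rad_op (1 / R\<^sup>2) (real m) ^^ m) J 0 (T y)"
        unfolding \<phi>J T_def a[symmetric] by (rule iter_laplacian_radial[OF open_UNIV JJ]) simp
      also have "\<dots> = (4 * (1 / R\<^sup>2)) ^ m * E (2 * m - 1) (T y)"
        by (rule rad_op_divergence_form[OF m1 _ that jets_subset[OF JJ] jets_subset[OF JE] JE1])
           (auto simp: S_def)
      finally show ?thesis unfolding Etop by simp
    qed
    have TS: "T y \<in> S" if "(norm y)\<^sup>2 \<ge> 1/2" for y
      using that R0 by (simp add: T S_def field_simps)
    have T1: "\<phi> y = 0" if "norm y > R" for y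
    proof -
      have "R\<^sup>2 \<le> (norm y)\<^sup>2" using that R0 by (intro power_mono) auto
      then show ?thesis using R0 by (simp add: \<phi>_def Ft_def T F(4))
    qed
    have T4: "T y \<le> 1/4" if "norm y < R / 2" for y
    proof -
      have "(norm y)\<^sup>2 \<le> (R / 2)\<^sup>2" using that by (intro power_mono) auto
      then show ?thesis using R0 by (simp add: T power_divide field_simps)
    qed
    have Tpow: "1 / T y ^ (m - 1) = R ^ (2 * m - 2) / norm y ^ (2 * m - 2)" for y
    proof -
      have "2 * m - 2 = 2 * (m - 1)" by simp
      then show ?thesis unfolding T by (simp add: power_divide power_mult)
    qed
    have lowV: "\<kappa> / R ^ (2 * m) * (indicator (ball 0 (R / 2)) y * V y) \<le> V y * iter_laplacian m \<phi> y" for y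
    proof (cases "(norm y)\<^sup>2 < 1/2")
      case False
      then have l: "iter_laplacian m \<phi> y = (4 / R\<^sup>2) ^ m * (e * (max 0 (1 - T y))\<^sup>2)" by (intro lap TS) simp
      have l0: "iter_laplacian m \<phi> y \<ge> 0" unfolding l using e by simp
      show ?thesis
      proof (cases "norm y < R / 2")
        case True
        have "(3/4)\<^sup>2 \<le> (max 0 (1 - T y))\<^sup>2" using T4[OF True] by (intro power_mono) auto
        then have "(4 / R\<^sup>2) ^ m * (e * (3/4)\<^sup>2) \<le> iter_laplacian m \<phi> y"
          unfolding l using e by (intro mult_left_mono) (simp_all only: zero_le_divide_iff zero_le_power2 zero_le_power zero_le_numeral less_imp_le simp_thms)
        moreover have "(4 / R\<^sup>2) ^ m * (e * (3/4)\<^sup>2) = \<kappa> / R ^ (2 * m)"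
          by (simp add: \<kappa>_def power_divide power_mult)
        ultimately have "\<kappa> / R ^ (2 * m) * V y \<le> iter_laplacian m \<phi> y * V y"
          using V(2)[of y] by (intro mult_right_mono) auto
        then show ?thesis using True by (simp add: mult.commute[of "V y"])
      next
        case False
        then show ?thesis using l0 V(2)[of y] by simp
      qed
    qed (simp add: V(3))
    have lowg: "cF * R ^ (2 * m - 2) * (indicator {y. 1 < norm y \<and> norm y < R / 2} y * (g y / norm y ^ (2 * m - 2)))
       - G0 * 2 ^ (m - 1) * R ^ (2 * m - 2) * indicator (cball 0 1) y \<le> g y * \<phi> y" for y
    proof (cases "norm y > 1")
      case True
      have T0: "T y > 0" unfolding T using True R0 by (intro divide_pos_pos zero_less_power) linarith+
      have "(norm y)\<^sup>2 > 1" using True by (simp add: one_less_power)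
      then have "T y \<in> S" by (intro TS) simp
      then have \<phi>F: "\<phi> y = F (T y)" by (simp add: \<phi>_def FtF)
      have g0: "g y \<ge> 0" using G[OF True] by (simp add: g_def)
      show ?thesis
      proof (cases "norm y < R / 2")
        case T2: True
        have "cF * (R ^ (2 * m - 2) / norm y ^ (2 * m - 2)) \<le> \<phi> y"
          unfolding \<phi>F Tpow[symmetric] using F(6)[OF T0 T4[OF T2]] by simp
        then show ?thesis using mult_left_mono[OF _ g0] True T2 by (fastforce simp: mult_ac)
      next
        case False
        then show ?thesis using g0 F(2)[OF T0] True by (simp add: \<phi>F)
      qed
    next
      case False
      then have n1: "norm y \<le> 1" by simp
      have "- (G0 * 2 ^ (m - 1) * R ^ (2 * m - 2)) \<le> g y * \<phi> y"
      proof (cases "(norm y)\<^sup>2 < 1/2")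
        case True
        then show ?thesis using gin[OF True] G00 R0 by simp
      next
        case False
        then have half: "1/2 \<le> (norm y)\<^sup>2" by simp
        then have TyS: "T y \<in> S" by (rule TS)
        have T1': "T y \<le> 1"
        proof -
          have "norm y \<le> R" using n1 R by linarith
          then show ?thesis using R0 by (simp add: T power_mono)
        qed
        have "\<phi> y \<le> R ^ (2 * m - 2) / norm y ^ (2 * m - 2)"
          using F(3)[OF S0[OF TyS] T1'] FtF[OF TyS] unfolding \<phi>_def Tpow by simp
        also have "norm y ^ (2 * m - 2) \<ge> (1/2) ^ (m - 1)"
        proof -
          have "2 * m - 2 = 2 * (m - 1)" by simp
          then have "norm y ^ (2 * m - 2) = ((norm y)\<^sup>2) ^ (m - 1)" by (simp add: power_mult)
          also have "\<dots> \<ge> (1/2) ^ (m - 1)" using half by (intro power_mono) auto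
          finally show ?thesis .
        qed
        then have "R ^ (2 * m - 2) / norm y ^ (2 * m - 2) \<le> R ^ (2 * m - 2) / (1/2) ^ (m - 1)"
          using R0 by (intro divide_left_mono mult_pos_pos) (auto intro: less_le_trans[rotated])
        also have "\<dots> = 2 ^ (m - 1) * R ^ (2 * m - 2)" by (simp add: power_one_over)
        finally have up: "\<phi> y \<le> 2 ^ (m - 1) * R ^ (2 * m - 2)" .
        have "\<phi> y \<ge> 0" using F(2)[OF S0[OF TyS]] FtF[OF TyS] by (simp add: \<phi>_def)
        then have "\<bar>g y * \<phi> y\<bar> \<le> G0 * (2 ^ (m - 1) * R ^ (2 * m - 2))"
          unfolding abs_mult using up G0[OF n1] by (intro mult_mono) auto
        then show ?thesis by (simp add: mult.assoc abs_le_iff)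
      qed
      then show ?thesis using False n1 by simp
    qed
    have int1: "integrable lborel (\<lambda>y. V y * iter_laplacian m \<phi> y)"
      by (rule integrable_compact_support[where R=R])
         (use Ck_on_iter_laplacian[OF open_UNIV, of 0 m \<phi>] Ck\<phi> in
           \<open>auto intro!: continuous_intros contV simp: vanishing_outside_iter_laplacian[OF T1]\<close>)
    have int2: "integrable lborel (\<lambda>y. g y * \<phi> y)"
      by (rule integrable_compact_support[where R=R])
         (use T1 in \<open>auto intro!: continuous_intros contg Ck_on_imp_continuous_on[OF Ck\<phi>]\<close>)
    have intV: "integrable lborel (\<lambda>y. indicator (ball 0 (R / 2)) y * V y)"
      by (intro integrable_indicator_continuous contV) auto
    have intI: "integrable lborel (indicator (cball 0 1) :: real^'n \<Rightarrow> real)"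
      using emeasure_bounded_finite[of "cball (0::real^'n) 1"] by (simp add: integrable_indicator_iff)
    have intg: "integrable lborel (\<lambda>y. indicator {y. 1 < norm y \<and> norm y < R / 2} y * (g y / norm y ^ (2 * m - 2)))"
    proof -
      define w where "w y = g y / max 1 (norm y) ^ (2 * m - 2)" for y
      have "continuous_on UNIV w" unfolding w_def by (intro continuous_intros contg) auto
      moreover have "{y::real^'n. 1 < norm y \<and> norm y < R / 2} \<in> sets borel" by measurable
      moreover have "bounded {y::real^'n. 1 < norm y \<and> norm y < R / 2}"
        by (rule bounded_subset[OF bounded_ball[of 0 "R / 2"]]) auto
      ultimately have "integrable lborel (\<lambda>y. indicator {y. 1 < norm y \<and> norm y < R / 2} y * w y)"
        by (rule integrable_indicator_continuous)
      also have "(\<lambda>y. indicator {y. 1 < norm y \<and> norm y < R / 2} y * w y)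
         = (\<lambda>y. indicator {y. 1 < norm y \<and> norm y < R / 2} y * (g y / norm y ^ (2 * m - 2)))"
        by (auto simp: w_def fun_eq_iff indicator_def)
      finally show ?thesis .
    qed
    have "\<kappa> / R ^ (2 * m) * (\<integral>y. indicator (ball 0 (R / 2)) y * V y \<partial>lborel)
      = (\<integral>y. \<kappa> / R ^ (2 * m) * (indicator (ball 0 (R / 2)) y * V y) \<partial>lborel)" by simp
    also have "\<dots> \<le> (\<integral>y. V y * iter_laplacian m \<phi> y \<partial>lborel)"
      by (intro integral_mono integrable_mult_right intV int1 lowV)
    also have "\<dots> = - (\<integral>y. g y * \<phi> y \<partial>lborel)"
      using integral_iter_laplacian_swap[OF V(1) Ck\<phi> T1] by (simp add: g_def)
    finally have 1: "\<kappa> / R ^ (2 * m) * (\<integral>y. indicator (ball 0 (R / 2)) y * V y \<partial>lborel) \<le> - (\<integral>y. g y * \<phi> y \<partial>lborel)" .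
    have "(\<integral>y. cF * R ^ (2 * m - 2) * (indicator {y. 1 < norm y \<and> norm y < R / 2} y * (g y / norm y ^ (2 * m - 2)))
       - G0 * 2 ^ (m - 1) * R ^ (2 * m - 2) * indicator (cball 0 1) y \<partial>lborel) \<le> (\<integral>y. g y * \<phi> y \<partial>lborel)"
      by (intro integral_mono Bochner_Integration.integrable_diff integrable_mult_right intg intI int2 lowg)
    then have "cF * R ^ (2 * m - 2) * (\<integral>y. indicator {y. 1 < norm y \<and> norm y < R / 2} y * (g y / norm y ^ (2 * m - 2)) \<partial>lborel)
       - G0 * 2 ^ (m - 1) * R ^ (2 * m - 2) * \<omega> \<le> (\<integral>y. g y * \<phi> y \<partial>lborel)"
      unfolding Bochner_Integration.integral_diff[OF integrable_mult_right[OF intg] integrable_mult_right[OF intI]]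
      unfolding integral_mult_right_zero \<omega>_def .
    with 1 show ?thesis by (simp add: C1_def mult_ac)
  qed
  have IV0: "(\<integral>y. indicator (ball 0 (R / 2)) y * V y \<partial>lborel) \<ge> 0" for R
    using V(2) by (intro integral_nonneg_AE) (auto simp: indicator_def)
  have Ig0: "(\<integral>y. indicator {y. 1 < norm y \<and> norm y < R / 2} y * (g y / norm y ^ (2 * m - 2)) \<partial>lborel) \<ge> 0" for R
    using G by (intro integral_nonneg_AE AE_I2) (auto simp: indicator_def g_def intro!: divide_nonpos_nonneg)
  define C where "C = C1 / \<kappa> + C1 / cF"
  have Cge: "C1 / \<kappa> \<le> C" "C1 / cF \<le> C" using C1 \<kappa> F(5) by (auto simp: C_def)
  show ?thesis
  proof
    fix R :: real assume R: "R \<ge> 2"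
    then have R0: "R > 0" by simp
    have "cF * R ^ (2 * m - 2) * (\<integral>y. indicator {y. 1 < norm y \<and> norm y < R / 2} y * (g y / norm y ^ (2 * m - 2)) \<partial>lborel) \<ge> 0"
      using Ig0[of R] F(5) R0 by (intro mult_nonneg_nonneg) auto
    with main[OF R] have "\<kappa> / R ^ (2 * m) * (\<integral>y. indicator (ball 0 (R / 2)) y * V y \<partial>lborel) \<le> C1 * R ^ (2 * m - 2)" by linarith
    then have "(\<integral>y. indicator (ball 0 (R / 2)) y * V y \<partial>lborel) \<le> C1 / \<kappa> * (R ^ (2 * m - 2) * R ^ (2 * m))"
      using \<kappa> R0 by (simp add: field_simps)
    also have "R ^ (2 * m - 2) * R ^ (2 * m) = R ^ (4 * m - 2)" using m by (simp add: power_add[symmetric])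
    also have "C1 / \<kappa> * R ^ (4 * m - 2) \<le> C * R ^ (4 * m - 2)" using Cge R0 by (intro mult_right_mono) auto
    finally show "(\<integral>y. indicator (ball 0 (R / 2)) y * V y \<partial>lborel) \<le> C * R ^ (4 * m - 2)" .
    have "\<kappa> / R ^ (2 * m) * (\<integral>y. indicator (ball 0 (R / 2)) y * V y \<partial>lborel) \<ge> 0"
      using IV0[of R] \<kappa> R0 by (intro mult_nonneg_nonneg) auto
    with main[OF R] have "(cF * (\<integral>y. indicator {y. 1 < norm y \<and> norm y < R / 2} y * (g y / norm y ^ (2 * m - 2)) \<partial>lborel)) * R ^ (2 * m - 2) \<le> C1 * R ^ (2 * m - 2)"
      by (simp add: mult_ac)
    then have "cF * (\<integral>y. indicator {y. 1 < norm y \<and> norm y < R / 2} y * (g y / norm y ^ (2 * m - 2)) \<partial>lborel) \<le> C1"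
      using R0 by (simp add: mult_le_cancel_right)
    then have "(\<integral>y. indicator {y. 1 < norm y \<and> norm y < R / 2} y * (g y / norm y ^ (2 * m - 2)) \<partial>lborel) \<le> C1 / cF"
      using F(5) by (simp add: field_simps)
    then show "(\<integral>y. indicator {y. 1 < norm y \<and> norm y < R / 2} y * (- iter_laplacian m V y / norm y ^ (2 * m - 2)) \<partial>lborel) \<le> C"
      using Cge unfolding g_def by linarith
  qed
qed

section \<open>Pointwise growth\<close>

text \<open>The cutoff acts on \<open>|y|\<^sup>2\<close> between 1/2 and 1. The open sets
  \<open>|y| > 1/2\<close> and \<open>|y|\<^sup>2 < 1/2\<close> overlap and cover the space, so
  smoothness can be glued.\<close>

lemma ex_smooth_truncation:
  fixes v :: "real^'n::finite \<Rightarrow> real"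
  assumes v: "Ck_on k {y. norm y > 1/2} v" and v0: "\<And>y. norm y > 1/2 \<Longrightarrow> v y \<ge> 0"
  obtains V where "Ck_on k UNIV V" "\<And>y. V y \<ge> 0" "\<And>y. (norm y)\<^sup>2 < 1/2 \<Longrightarrow> V y = 0"
    "\<And>y. norm y > 1 \<Longrightarrow> V y = v y"
proof -
  obtain \<eta> :: "real \<Rightarrow> real" where \<eta>: "Dk_on k UNIV \<eta>" "\<And>t. t \<le> 1/2 \<Longrightarrow> \<eta> t = 0" "\<And>t. 1 \<le> t \<Longrightarrow> \<eta> t = 1"
    "\<And>t. 0 \<le> \<eta> t" by (rule ex_cutoff[of "1/2" 1 k]) auto
  define V where "V y = \<eta> (1 * (norm (y - 0))\<^sup>2) * v y" for y
  have z: "V y = 0" if "(norm y)\<^sup>2 < 1/2" for y using that by (simp add: V_def \<eta>(2))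
  have oA: "open {y::real^'n. norm y > 1/2}" and oB: "open {y::real^'n. (norm y)\<^sup>2 < 1/2}"
    by (intro open_Collect_less continuous_intros)+
  have half: "(norm y)\<^sup>2 < 1/2" if "norm y \<le> 1/2" for y :: "real^'n"
  proof -
    have "(norm y)\<^sup>2 \<le> (1/2)\<^sup>2" using that by (intro power_mono) auto
    then show ?thesis by (simp add: power2_eq_square)
  qed
  have "Ck_on k UNIV (\<lambda>y::real^'n. (deriv ^^ 0) \<eta> (1 * (norm (y - 0))\<^sup>2))"
    by (rule Ck_on_radial[OF open_UNIV jets_deriv[OF \<eta>(1)]]) simp
  then have "Ck_on k UNIV (\<lambda>y::real^'n. \<eta> (1 * (norm (y - 0))\<^sup>2))" by (simp only: funpow.simps id_apply)
  then have "Ck_on k {y. norm y > 1/2} V"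
    unfolding V_def by (intro Ck_on_mult[OF oA] v) (rule Ck_on_subset, auto)
  moreover have "Ck_on k {y. (norm y)\<^sup>2 < 1/2} V"
    by (rule Ck_on_cong[OF oB _ Ck_on_const[OF oB, of k 0]]) (simp add: z)
  ultimately have "Ck_on k ({y. norm y > 1/2} \<union> {y. (norm y)\<^sup>2 < 1/2}) V" by (rule Ck_on_Un[OF oA oB])
  moreover have "{y. norm y > 1/2} \<union> {y. (norm y)\<^sup>2 < 1/2} = (UNIV :: (real^'n) set)"
  proof -
    have "y \<in> {y. norm y > 1/2} \<union> {y. (norm y)\<^sup>2 < 1/2}" for y :: "real^'n"
      using half[of y] by (cases "norm y \<le> 1/2") auto
    then show ?thesis by blast
  qed
  ultimately have 1: "Ck_on k UNIV V" by simp
  have 2: "V y \<ge> 0" for y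
    using half[of y] z[of y] v0[of y] \<eta>(4) by (cases "norm y \<le> 1/2") (auto simp: V_def)
  have 3: "V y = v y" if "norm y > 1" for y
    using that one_less_power[of "norm y" 2] by (simp add: V_def \<eta>(3))
  show ?thesis by (rule that[OF 1 2 z 3])
qed

lemma powr_growth_bound:
  fixes f :: "real \<Rightarrow> real"
  assumes cont: "continuous_on {0..} f" and f: "f \<in> O[at_top](\<lambda>t. t powr \<sigma>)" and \<sigma>: "\<sigma> > 0"
  obtains K where "K > 0" "\<And>t. t \<ge> 0 \<Longrightarrow> f t \<le> K * (1 + t) powr \<sigma>"
proof -
  obtain c where c: "c > 0" "eventually (\<lambda>t. norm (f t) \<le> c * norm (t powr \<sigma>)) at_top"
    using f by (elim landau_o.bigE)
  then obtain t0 where t0: "\<And>t. t \<ge> t0 \<Longrightarrow> \<bar>f t\<bar> \<le> c * t powr \<sigma>" by (auto simp: eventually_at_top_linorder)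
  have "compact (f ` {0..\<bar>t0\<bar>})" by (intro compact_continuous_image continuous_on_subset[OF cont]) auto
  then obtain M where "\<forall>z\<in>f ` {0..\<bar>t0\<bar>}. norm z \<le> M"
    by (blast dest: compact_imp_bounded[THEN bounded_iff[THEN iffD1]])
  then have M: "f t \<le> \<bar>M\<bar>" if "0 \<le> t" "t \<le> \<bar>t0\<bar>" for t using that by force
  show ?thesis
  proof
    show "c + \<bar>M\<bar> > 0" using c by simp
    fix t :: real assume t: "t \<ge> 0"
    have p1: "(1 + t) powr \<sigma> \<ge> 1" using t \<sigma> by (intro ge_one_powr_ge_zero) auto
    show "f t \<le> (c + \<bar>M\<bar>) * (1 + t) powr \<sigma>"
    proof (cases "t \<le> \<bar>t0\<bar>")
      case True
      have "f t \<le> \<bar>M\<bar> * 1" using M[OF t True] by simp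
      also have "\<dots> \<le> (c + \<bar>M\<bar>) * (1 + t) powr \<sigma>" using p1 c by (intro mult_mono) auto
      finally show ?thesis .
    next
      case False
      then have "f t \<le> c * t powr \<sigma>" using t0[of t] by linarith
      also have "\<dots> \<le> (c + \<bar>M\<bar>) * (1 + t) powr \<sigma>"
        using t \<sigma> c by (intro mult_mono powr_mono2) auto
      finally show ?thesis .
    qed
  qed
qed

text \<open>The point maximises \<open>(R - dist y y0) ^ n * V y\<close>.\<close>

lemma doubling_point:
  fixes V :: "real^'n::finite \<Rightarrow> real"
  assumes V: "continuous_on UNIV V" "\<And>y. V y \<ge> 0" and "V y0 > 0" and R: "R > 0" and n: "n \<ge> 1"
  obtains y1 d where "0 < d" "dist y1 y0 + d = R" "R ^ n * V y0 \<le> d ^ n * V y1"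
    "\<And>y. dist y y1 \<le> d / 2 \<Longrightarrow> V y \<le> 2 ^ n * V y1"
proof -
  define w where "w y = (R - dist y y0) ^ n * V y" for y
  have "continuous_on (cball y0 R) w" unfolding w_def
    by (intro continuous_intros continuous_on_subset[OF V(1)]) auto
  then obtain y1 where y1: "y1 \<in> cball y0 R" "\<And>y. y \<in> cball y0 R \<Longrightarrow> w y \<le> w y1"
    using continuous_attains_sup[of "cball y0 R" w] R by auto
  define d where "d = R - dist y1 y0"
  have w0: "R ^ n * V y0 \<le> w y1" using y1(2)[of y0] R by (simp add: w_def)
  moreover have "R ^ n * V y0 > 0" using assms by simp
  ultimately have "w y1 > 0" by linarith
  then have "d \<noteq> 0" using n by (auto simp: w_def d_def power_0_left)
  moreover have "d \<ge> 0" using y1(1) by (simp add: d_def dist_commute)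
  ultimately have d: "d > 0" by simp
  show ?thesis
  proof (rule that[OF d])
    show "dist y1 y0 + d = R" by (simp add: d_def)
    show "R ^ n * V y0 \<le> d ^ n * V y1" using w0 by (simp add: w_def d_def)
    fix y assume y: "dist y y1 \<le> d / 2"
    have tri: "dist y y0 \<le> dist y y1 + dist y1 y0" by (rule dist_triangle)
    \<comment> \<open>Within \<open>d / 2\<close> of \<open>y1\<close> the weight drops at most by
      the factor \<open>2 ^ n\<close>, so maximality of \<open>w\<close> at \<open>y1\<close>
      becomes a bound on \<open>V\<close>.\<close>
    then have "R - dist y y0 \<ge> d / 2" using y by (simp add: d_def)
    then have "(d / 2) ^ n * V y \<le> w y" unfolding w_def using d V(2) by (intro mult_right_mono power_mono) auto
    also have "w y \<le> w y1" using y tri d by (intro y1(2)) (simp add: d_def dist_commute)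
    also have "w y1 = d ^ n * V y1" by (simp add: w_def d_def)
    finally show "V y \<le> 2 ^ n * V y1" using d by (simp add: power_divide field_simps)
  qed
qed

text \<open>The masses of growing annuli increase to a finite supremum, so little is left beyond a
  radius where it is nearly attained. This smallness turns O into o.\<close>

lemma annulus_integral_small:
  fixes g :: "real^'n::finite \<Rightarrow> real"
  assumes g: "continuous_on UNIV g" "\<And>y. norm y > 1 \<Longrightarrow> g y \<ge> 0"
    and C: "\<And>s. s \<ge> 1 \<Longrightarrow> (\<integral>y. indicator {y. 1 < norm y \<and> norm y < s} y * g y \<partial>lborel) \<le> C"
    and e: "e > 0"
  obtains s0 where "s0 > 1" "\<And>s t. s0 \<le> s \<Longrightarrow> s \<le> t \<Longrightarrow> (\<integral>y. indicator {y. s \<le> norm y \<and> norm y < t} y * g y \<partial>lborel) \<le> e"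
proof -
  define \<mu> where "\<mu> s = (\<integral>y. indicator {y. 1 < norm y \<and> norm y < s} y * g y \<partial>lborel)" for s
  have i: "integrable lborel (\<lambda>y. indicator {y. 1 < norm y \<and> norm y < s} y * g y)" for s
  proof (rule integrable_indicator_continuous[OF g(1)])
    show "{y::real^'n. 1 < norm y \<and> norm y < s} \<in> sets borel" by measurable
    show "bounded {y::real^'n. 1 < norm y \<and> norm y < s}" by (rule bounded_subset[OF bounded_ball[of 0 s]]) auto
  qed
  have mono: "\<mu> s \<le> \<mu> t" if "s \<le> t" for s t unfolding \<mu>_def
    using that g(2) by (intro integral_mono i) (auto simp: indicator_def)
  have bdd: "bdd_above (\<mu> ` {1<..})" using C by (auto simp: \<mu>_def bdd_above_def intro!: exI[of _ C])
  define L where "L = (SUP s\<in>{1<..}. \<mu> s)"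
  have "L - e < L" using e by simp
  then obtain s0 where s0: "s0 > 1" "L - e < \<mu> s0"
    unfolding L_def using less_cSUP_iff[OF _ bdd, of "L - e"] by (auto simp: L_def)
  show ?thesis
  proof (rule that[OF s0(1)])
    fix s t assume st: "s0 \<le> s" "s \<le> t"
    have "(\<lambda>y. indicator {y. s \<le> norm y \<and> norm y < t} y * g y)
      = (\<lambda>y. indicator {y. 1 < norm y \<and> norm y < t} y * g y - indicator {y. 1 < norm y \<and> norm y < s} y * g y)"
      using st s0(1) by (auto simp: fun_eq_iff indicator_def)
    then have "(\<integral>y. indicator {y. s \<le> norm y \<and> norm y < t} y * g y \<partial>lborel) = \<mu> t - \<mu> s"
      unfolding \<mu>_def by (simp add: i)
    moreover have "\<mu> t \<le> L" unfolding L_def using st s0 bdd by (intro cSUP_upper) auto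
    moreover have "\<mu> s \<ge> \<mu> s0" by (rule mono[OF st(1)])
    ultimately show "(\<integral>y. indicator {y. s \<le> norm y \<and> norm y < t} y * g y \<partial>lborel) \<le> e" using s0(2) by linarith
  qed
qed

text \<open>From \<open>1 + X \<le> (1 + Q) * (1 + X / Q)\<close> follows
  \<open>ln (1 + X) \<le> p * L + X / Q\<close>. Multiplied by \<open>b * Q * s\<close>, the last
  term becomes \<open>b * s * X\<close>, small enough to be absorbed on the left.\<close>

lemma log_absorption:
  fixes X Q :: real
  assumes "X \<ge> 0" "Q \<ge> 1" "c > 0" "b \<ge> 0" "s \<ge> 0"
    and X: "c / 2 * X \<le> b * Q * (L + s * ln (1 + X))"
    and Q: "ln (1 + Q) \<le> p * L" and b: "b * s \<le> c / 4" "4 * (b * (1 + s * p)) \<le> c * \<delta>" and L: "L \<ge> 0"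
  shows "X \<le> \<delta> * Q * L"
proof -
  have "ln (1 + X) \<le> ln ((1 + Q) * (1 + X / Q))"
  proof (intro ln_mono)
    have "(1 + Q) * (1 + X / Q) = 1 + X + Q + X / Q" using assms(2) by (simp add: field_simps)
    then show "1 + X \<le> (1 + Q) * (1 + X / Q)" using assms by simp
  qed (use assms in auto)
  also have "\<dots> = ln (1 + Q) + ln (1 + X / Q)"
  proof (rule ln_mult_pos)
    show "0 < 1 + X / Q" using assms by (intro add_pos_nonneg) auto
  qed (use assms in auto)
  also have "ln (1 + X / Q) \<le> X / Q" using assms by (intro ln_add_one_self_le_self) auto
  finally have l: "ln (1 + X) \<le> p * L + X / Q" using Q by linarith
  have "c / 2 * X \<le> b * Q * (L + s * (p * L + X / Q))"
    using X l assms by (intro order_trans[OF X] mult_left_mono add_left_mono) auto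
  also have "\<dots> = (b * (1 + s * p)) * Q * L + b * s * X" using assms by (simp add: field_simps)
  also have "b * s * X \<le> c / 4 * X" using b assms by (intro mult_right_mono) auto
  finally have "c / 2 * X \<le> b * (1 + s * p) * Q * L + c / 4 * X" by simp
  moreover have "c / 2 * X = c * X / 2" "c / 4 * X = c * X / 4"
    "4 * (b * (1 + s * p)) * (Q * L) = 4 * (b * (1 + s * p) * Q * L)" by simp_all
  ultimately have "c * X \<le> 4 * (b * (1 + s * p)) * (Q * L)" by linarith
  also have "\<dots> \<le> c * \<delta> * (Q * L)" using b L assms by (intro mult_right_mono) auto
  finally show ?thesis using assms(3) by (simp add: mult.assoc)
qed

theorem theorem1p15:
  fixes m :: nat and \<sigma> :: real
    and f :: "real \<Rightarrow> real"
    and v :: "real^'n::finite \<Rightarrow> real"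
  assumes m_odd: "odd m" and m_ge: "m \<ge> 3"
    and dim: "CARD('n) = 2 * m"
    and f_cont: "continuous_on {0..} f"
    and f_nonneg: "\<And>t. t \<ge> 0 \<Longrightarrow> f t \<ge> 0"
    and sigma_pos: "\<sigma> > 0"
    and f_growth: "f \<in> O[at_top](\<lambda>t. t powr \<sigma>)"
    and v_smooth: "Ck_on (2 * m) {y. norm y > 1/2} v"
    and v_nonneg: "\<And>y. norm y > 1/2 \<Longrightarrow> v y \<ge> 0"
    and ineq_lower: "\<And>y. norm y > 1/2 \<Longrightarrow> 0 \<le> - iter_laplacian m v y"
    and ineq_upper: "\<And>y. norm y > 1/2 \<Longrightarrow> - iter_laplacian m v y \<le> f (v y)"
  shows "v \<in> o[at_infinity](\<lambda>y. norm y ^ (2 * m - 2) * ln (5 * norm y))"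
proof -
  have m2: "m \<ge> 2" using m_ge by simp
  obtain V where V: "Ck_on (2 * m) UNIV V" "\<And>y. V y \<ge> 0" "\<And>y. (norm y)\<^sup>2 < 1/2 \<Longrightarrow> V y = 0"
    "\<And>y. norm y > 1 \<Longrightarrow> V y = v y"
    by (rule ex_smooth_truncation[OF v_smooth v_nonneg]) blast+
  have contV: "continuous_on UNIV V" using V(1) by (rule Ck_on_imp_continuous_on)
  define g where "g y = - iter_laplacian m V y" for y
  have contg: "continuous_on UNIV g" unfolding g_def
    using Ck_on_iter_laplacian[OF open_UNIV, of 0 m V] V(1) by (simp add: continuous_on_minus)
  have gv: "g y = - iter_laplacian m v y" if "norm y > 1" for y
  proof -
    have "open {y::real^'n. norm y > 1}" by (intro open_Collect_less continuous_intros)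
    then have "iter_laplacian m V y = iter_laplacian m v y"
      by (rule iter_laplacian_cong) (use that V(4) in auto)
    then show ?thesis by (simp add: g_def)
  qed
  have g0: "g y \<ge> 0" if "norm y > 1" for y using ineq_lower[of y] that by (simp add: gv)
  obtain K where K: "K > 0" "\<And>t. t \<ge> 0 \<Longrightarrow> f t \<le> K * (1 + t) powr \<sigma>"
    using powr_growth_bound[OF f_cont f_growth sigma_pos] by blast
  have gK: "g y \<le> K * (1 + V y) powr \<sigma>" if "norm y > 1" for y
    using ineq_upper[of y] K(2)[OF V(2)[of y]] that by (simp add: gv V(4))
  obtain Cg' where Cg': "\<And>R. R \<ge> 2 \<Longrightarrow> (\<integral>y. indicator (ball 0 (R / 2)) y * V y \<partial>lborel) \<le> Cg' * R ^ (4 * m - 2)"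
    "\<And>R. R \<ge> 2 \<Longrightarrow> (\<integral>y. indicator {y. 1 < norm y \<and> norm y < R / 2} y * (g y / norm y ^ (2 * m - 2)) \<partial>lborel) \<le> Cg'"
    using growth_bound[OF dim m2 V(1-3)] g0 unfolding g_def by blast
  define Cg where "Cg = \<bar>Cg'\<bar>"
  have Cg: "(\<integral>y. indicator (ball 0 (R / 2)) y * V y \<partial>lborel) \<le> Cg * R ^ (4 * m - 2)" if "R \<ge> 2" for R
  proof -
    have "Cg' * R ^ (4 * m - 2) \<le> Cg * R ^ (4 * m - 2)" unfolding Cg_def using that by (intro mult_right_mono) auto
    then show ?thesis using Cg'(1)[OF that] by linarith
  qed
  obtain c C where cC: "c > 0" "C \<ge> 0"
    "\<And>(V :: real^'n \<Rightarrow> real) y1 d \<rho> \<Gamma>. Ck_on (2 * m) UNIV V \<Longrightarrow> (\<And>y. V y \<ge> 0) \<Longrightarrow> 0 < \<rho> \<Longrightarrow> \<rho> \<le> d \<Longrightarrow>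
      (\<And>y. y \<in> ball y1 d \<Longrightarrow> 0 \<le> - iter_laplacian m V y \<and> - iter_laplacian m V y \<le> \<Gamma>) \<Longrightarrow>
      c * V y1 \<le> C / d ^ (2 * m) * (\<integral>y. indicator (ball y1 d) y * V y \<partial>lborel)
        + ln (d\<^sup>2 / \<rho>\<^sup>2) * (\<integral>y. indicator (ball y1 d) y * - iter_laplacian m V y \<partial>lborel)
        + 4 * unit_ball_vol (2 * real m) * \<rho> ^ (2 * m) * \<Gamma>"
    by (rule local_estimate[OF dim m_odd]) blast
  \<comment> \<open>With this exponent \<open>((1 + X) powr (- s)) ^ (2 * m)\<close> is the
    reciprocal of \<open>(1 + X) powr \<sigma>\<close>, so the volume of a small ball cancels the
    bound on \<open>g\<close>.\<close>
  define s where "s = \<sigma> / real (2 * m)"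
  have s0: "s > 0" using sigma_pos m2 by (simp add: s_def)
  define p where "p = real (2 * m - 2)"
  have p0: "p \<ge> 0" by (simp add: p_def)
  have key: "eventually (\<lambda>y. V y \<le> \<delta> * (norm y ^ (2 * m - 2) * ln (5 * norm y))) at_infinity" if \<delta>: "\<delta> > 0" for \<delta>
  proof -
    define b where "b = min (c / (4 * s)) (c * \<delta> / (4 * (1 + s * p)))"
    have b0: "b > 0" using cC(1) s0 p0 \<delta> by (auto simp: b_def intro!: divide_pos_pos mult_pos_pos add_pos_nonneg)
    have bs: "b * s \<le> c / 4"
    proof -
      have "b * s \<le> c / (4 * s) * s" using s0 by (intro mult_right_mono) (auto simp: b_def)
      then show ?thesis using s0 by simp
    qed
    have sp: "1 + s * p > 0" using s0 p0 by (intro add_pos_nonneg) auto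
    have bp: "4 * (b * (1 + s * p)) \<le> c * \<delta>"
    proof -
      have "b * (1 + s * p) \<le> c * \<delta> / (4 * (1 + s * p)) * (1 + s * p)" using sp by (intro mult_right_mono) (auto simp: b_def)
      also have "\<dots> = c * \<delta> / 4"
      proof -
        have "c * \<delta> / (4 * u) * u = c * \<delta> / 4" if "u > 0" for u :: real using that by simp
        then show ?thesis using sp by blast
      qed
      finally show ?thesis by simp
    qed
    \<comment> \<open>The divisor is \<open>2 * 2 ^ (2 * m - 2)\<close>: one 2 from the squares in
      \<open>ln (d\<^sup>2 / \<rho>\<^sup>2)\<close>, the rest from \<open>norm y < 2 * r\<close> in
      the weight.\<close>
    define e where "e = b / 2 ^ (2 * m - 1)"
    have e0: "e > 0" using b0 by (simp add: e_def)
    \<comment> \<open>\<open>max 1\<close> makes the weighted density continuous on the whole space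
      without changing it where \<open>norm y > 1\<close>.\<close>
    define g1 where "g1 y = g y / max 1 (norm y) ^ (2 * m - 2)" for y
    have g1: "continuous_on UNIV g1" unfolding g1_def by (intro continuous_intros contg) auto
    have g10: "g1 y \<ge> 0" if "norm y > 1" for y using g0[OF that] by (simp add: g1_def)
    have "(\<integral>y. indicator {y. 1 < norm y \<and> norm y < s} y * g1 y \<partial>lborel) \<le> Cg'" if "s \<ge> 1" for s
    proof -
      have "(\<lambda>y. indicator {y. 1 < norm y \<and> norm y < s} y * g1 y)
        = (\<lambda>y. indicator {y. 1 < norm y \<and> norm y < (2 * s) / 2} y * (g y / norm y ^ (2 * m - 2)))"
        by (auto simp: fun_eq_iff indicator_def g1_def)
      then show ?thesis using Cg'(2)[of "2 * s"] that by simp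
    qed
    then obtain s1 where s1: "s1 > 1"
      "\<And>s t. s1 \<le> s \<Longrightarrow> s \<le> t \<Longrightarrow> (\<integral>y. indicator {y. s \<le> norm y \<and> norm y < t} y * g1 y \<partial>lborel) \<le> e"
      using annulus_integral_small[OF g1 g10 _ e0, of Cg'] by blast
    \<comment> \<open>\<open>4 ^ (2 * m)\<close> comes from the two halvings \<open>r / 2\<close>
      and \<open>d = d1 / 2\<close>, and \<open>4 ^ (4 * m - 2)\<close> from enclosing the ball
      around \<open>y1\<close> in the one of radius \<open>(4 * r) / 2\<close>.\<close>
    define A where "A = C * Cg * 4 ^ (2 * m) * 4 ^ (4 * m - 2)"
    define M where "M = 4 * unit_ball_vol (2 * real m) * (K * (2 ^ (2 * m)) powr \<sigma>)"
    have A0: "A \<ge> 0" using cC by (simp add: A_def Cg_def)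
    have M0: "M \<ge> 0" using K by (simp add: M_def)
    \<comment> \<open>The first entry pushes the annulus \<open>r / 2 \<le> norm y\<close> beyond
      \<open>s1\<close>; the second yields
      \<open>4 * (A + M) \<le> c * (\<delta> * L)\<close>.\<close>
    define r0 where "r0 = max (2 * s1) (exp (4 * (A + M) / (c * \<delta>)))"
    have "V y0 \<le> \<delta> * (norm y0 ^ (2 * m - 2) * ln (5 * norm y0))" if r0: "norm y0 \<ge> r0" for y0
    proof (rule ccontr)
      define r where "r = norm y0"
      define L where "L = ln (5 * r)"
      define Q where "Q = r ^ (2 * m - 2)"
      have r: "r \<ge> 2 * s1" "r > 2" "r \<ge> exp (4 * (A + M) / (c * \<delta>))" using r0 s1(1) by (auto simp: r_def r0_def)
      have Lr: "ln r \<le> L" "L > 0" using r(2) by (auto simp: L_def)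
      have "4 * (A + M) / (c * \<delta>) \<le> ln r" using r(2,3) by (simp add: ln_ge_iff)
      then have "4 * (A + M) / (c * \<delta>) \<le> L" using Lr(1) by (rule order_trans)
      then have "4 * (A + M) \<le> L * (c * \<delta>)" using cC(1) \<delta> by (simp only: pos_divide_le_eq mult_pos_pos)
      then have LAM: "4 * (A + M) \<le> c * (\<delta> * L)" by (simp only: mult_ac)
      have Q1: "Q \<ge> 1" unfolding Q_def using r(2) by (intro one_le_power) simp
      assume "\<not> V y0 \<le> \<delta> * (norm y0 ^ (2 * m - 2) * ln (5 * norm y0))"
      then have V0: "V y0 > \<delta> * Q * L" by (simp add: Q_def L_def r_def mult.assoc)
      have dQL: "\<delta> * Q * L > 0" using \<delta> Q1 Lr by simp
      have V0p: "V y0 > 0" using V0 dQL by linarith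
      have V0L: "V y0 \<ge> \<delta> * L"
      proof -
        have "\<delta> * L * 1 \<le> \<delta> * L * Q" using \<delta> Q1 Lr by (intro mult_left_mono) auto
        then show ?thesis using V0 by (simp add: mult_ac)
      qed
      \<comment> \<open>The radius \<open>r / 2\<close> keeps the ball away from the origin. The
        exponent \<open>2 * m\<close> matches the volume of the ball, so that a small
        \<open>d1\<close> is paid for by a large \<open>V y1\<close>.\<close>
      obtain y1 d1 where y1: "0 < d1" "dist y1 y0 + d1 = r / 2" "(r / 2) ^ (2 * m) * V y0 \<le> d1 ^ (2 * m) * V y1"
        "\<And>y. dist y y1 \<le> d1 / 2 \<Longrightarrow> V y \<le> 2 ^ (2 * m) * V y1"
      proof -
        have "r / 2 > 0" "2 * m \<ge> 1" using r(2) m2 by auto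
        from doubling_point[OF contV V(2) V0p this] show ?thesis using that by blast
      qed
      define d where "d = d1 / 2"
      define X where "X = V y1"
      have d: "d > 0" "d \<le> r" using y1(1,2) zero_le_dist[of y1 y0] r(2) by (auto simp: d_def simp del: zero_le_dist)
      have XV0: "X \<ge> V y0"
      proof -
        have "d1 ^ (2 * m) * X \<le> (r / 2) ^ (2 * m) * X"
          using y1(1,2) zero_le_dist[of y1 y0] V(2)[of y1] unfolding X_def
          by (intro mult_right_mono power_mono) (auto simp del: zero_le_dist)
        then have "(r / 2) ^ (2 * m) * V y0 \<le> (r / 2) ^ (2 * m) * X" using y1(3) by (simp add: X_def)
        then show ?thesis using r(2) by (simp add: mult_le_cancel_left)
      qed
      then have X0: "X > 0" using V0p by simp
      have ball: "r / 2 \<le> norm y \<and> norm y < 2 * r" if "y \<in> ball y1 d" for y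
      proof -
        have "dist y y0 < r / 2"
          using that dist_triangle[of y y0 y1] y1(1,2) by (simp add: d_def dist_commute)
        then show ?thesis using norm_triangle_ineq2[of y0 y] norm_triangle_ineq2[of y y0] r(2)
          by (auto simp: dist_norm norm_minus_commute r_def)
      qed
      have ball1: "norm y > 1" if "y \<in> ball y1 d" for y using ball[OF that] r(2) by linarith
      define \<Gamma> where "\<Gamma> = K * (1 + 2 ^ (2 * m) * X) powr \<sigma>"
      \<comment> \<open>The factor \<open>1 / r\<close> compensates \<open>d \<le> r\<close>, and
        the power of \<open>1 + X\<close> compensates \<Gamma>; \<open>d / \<rho>\<close> is
        \<open>r * (1 + X) powr s\<close>, whose logarithm is affordable.\<close>
      define \<rho> where "\<rho> = d * (1 + X) powr (- s) / r"
      have \<rho>: "\<rho> > 0" using d r(2) X0 by (simp add: \<rho>_def)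
      have le1: "(1 + X) powr (- s) \<le> 1" using powr_mono[of "-s" 0 "1 + X"] X0 s0 by simp
      have \<rho>d: "\<rho> \<le> d"
      proof -
        have "\<rho> \<le> d * 1 / 1" unfolding \<rho>_def using d r(2) le1 by (intro frac_le mult_left_mono) auto
        then show ?thesis by simp
      qed
      have G: "0 \<le> - iter_laplacian m V y \<and> - iter_laplacian m V y \<le> \<Gamma>" if y: "y \<in> ball y1 d" for y
      proof
        show "0 \<le> - iter_laplacian m V y" using g0[OF ball1[OF y]] by (simp add: g_def)
        have "V y \<le> 2 ^ (2 * m) * X" unfolding X_def using y by (intro y1(4)) (simp add: d_def dist_commute)
        then have "K * (1 + V y) powr \<sigma> \<le> \<Gamma>" unfolding \<Gamma>_def
          using K(1) sigma_pos V(2)[of y] by (intro mult_left_mono powr_mono2) auto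
        then show "- iter_laplacian m V y \<le> \<Gamma>" using gK[OF ball1[OF y]] by (simp add: g_def)
      qed
      have est: "c * X \<le> C / d ^ (2 * m) * (\<integral>y. indicator (ball y1 d) y * V y \<partial>lborel)
        + ln (d\<^sup>2 / \<rho>\<^sup>2) * (\<integral>y. indicator (ball y1 d) y * g y \<partial>lborel)
        + 4 * unit_ball_vol (2 * real m) * \<rho> ^ (2 * m) * \<Gamma>"
        using cC(3)[OF V(1,2) \<rho> \<rho>d G] by (simp add: X_def g_def)
      \<comment> \<open>The doubling inequality trades \<open>1 / d ^ (2 * m)\<close> for a multiple
        of \<open>X / (r ^ (2 * m) * V y0)\<close>. With \<open>V y0 > \<delta> * Q * L\<close> the
        term is at most \<open>A / (\<delta> * L) * X\<close>, small for large
        \<open>L\<close>.\<close>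
      have t1: "C / d ^ (2 * m) * (\<integral>y. indicator (ball y1 d) y * V y \<partial>lborel) \<le> c / 4 * X"
      proof -
        have "(\<integral>y. indicator (ball y1 d) y * V y \<partial>lborel) \<le> (\<integral>y. indicator (ball 0 ((4 * r) / 2)) y * V y \<partial>lborel)"
          by (intro integral_mono integrable_indicator_continuous contV)
             (use ball V(2) in \<open>auto simp: indicator_def\<close>)
        also have "\<dots> \<le> Cg * (4 * r) ^ (4 * m - 2)" using r(2) by (intro Cg) simp
        finally have "C / d ^ (2 * m) * (\<integral>y. indicator (ball y1 d) y * V y \<partial>lborel) \<le> C / d ^ (2 * m) * (Cg * (4 * r) ^ (4 * m - 2))"
          using cC(2) d by (intro mult_left_mono) auto
        also have "\<dots> = C * Cg * 4 ^ (4 * m - 2) * r ^ (4 * m - 2) * (1 / d ^ (2 * m))"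
          by (simp add: power_mult_distrib)
        also have "\<dots> \<le> C * Cg * 4 ^ (4 * m - 2) * r ^ (4 * m - 2) * (4 ^ (2 * m) * X / (r ^ (2 * m) * V y0))"
        proof (rule mult_left_mono)
          have "(r / 2) ^ (2 * m) * V y0 \<le> 2 ^ (2 * m) * d ^ (2 * m) * X"
            using y1(3) by (simp add: d_def X_def power_divide)
          then have "r ^ (2 * m) * V y0 \<le> (2 ^ (2 * m) * 2 ^ (2 * m)) * X * d ^ (2 * m)"
            by (simp add: power_divide field_simps)
          also have "(2::real) ^ (2 * m) * 2 ^ (2 * m) = 4 ^ (2 * m)" by (simp add: power_mult_distrib[symmetric])
          finally show "1 / d ^ (2 * m) \<le> 4 ^ (2 * m) * X / (r ^ (2 * m) * V y0)"
            using d r(2) V0p by (simp add: field_simps)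
          show "0 \<le> C * Cg * 4 ^ (4 * m - 2) * r ^ (4 * m - 2)" using cC(2) r(2) by (simp add: Cg_def)
        qed
        also have "\<dots> = A * X * (r ^ (4 * m - 2) / r ^ (2 * m)) / V y0" by (simp add: A_def field_simps)
        also have "r ^ (4 * m - 2) / r ^ (2 * m) = Q"
        proof -
          have "4 * m - 2 = (2 * m - 2) + 2 * m" using m2 by simp
          then show ?thesis using r(2) by (simp add: Q_def power_add)
        qed
        also have "A * X * Q / V y0 \<le> A * X * Q / (\<delta> * Q * L)"
          using V0 dQL A0 X0 Q1 V0p \<delta> Lr by (intro divide_left_mono mult_pos_pos) auto
        also have "\<dots> = A / (\<delta> * L) * X" using Q1 by simp
        also have "\<dots> \<le> c / 4 * X"
        proof (rule mult_right_mono)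
          show "A / (\<delta> * L) \<le> c / 4" using LAM M0 \<delta> Lr by (simp add: divide_le_eq)
        qed (use X0 in simp)
        finally show ?thesis .
      qed
      \<comment> \<open>The mass of \<open>g\<close> near \<open>y1\<close> is at most
        \<open>(2 * r) ^ (2 * m - 2)\<close> times a tail of the convergent integral.\<close>
      have t2: "ln (d\<^sup>2 / \<rho>\<^sup>2) * (\<integral>y. indicator (ball y1 d) y * g y \<partial>lborel) \<le> b * Q * (L + s * ln (1 + X))"
      proof -
        have "ln (d\<^sup>2 / \<rho>\<^sup>2) = 2 * (ln d - ln \<rho>)" using d \<rho> by (simp add: ln_div ln_realpow)
        also have "ln \<rho> = ln d - s * ln (1 + X) - ln r"
          using d r(2) X0 unfolding \<rho>_def by (simp add: ln_div ln_mult ln_powr)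
        finally have lneq: "ln (d\<^sup>2 / \<rho>\<^sup>2) = 2 * (ln r + s * ln (1 + X))" by simp
        have lX: "ln (1 + X) \<ge> 0" using X0 by simp
        have "(\<integral>y. indicator (ball y1 d) y * g y \<partial>lborel)
          \<le> (\<integral>y. (2 * r) ^ (2 * m - 2) * (indicator {y. r / 2 \<le> norm y \<and> norm y < 2 * r} y * g1 y) \<partial>lborel)"
        proof (intro integral_mono integrable_mult_right integrable_indicator_continuous contg g1)
          show "{y::real^'n. r / 2 \<le> norm y \<and> norm y < 2 * r} \<in> sets borel" by measurable
          show "bounded {y::real^'n. r / 2 \<le> norm y \<and> norm y < 2 * r}"
            by (rule bounded_subset[OF bounded_ball[of 0 "2 * r"]]) auto
          fix y
          show "indicator (ball y1 d) y * g y \<le> (2 * r) ^ (2 * m - 2) * (indicator {y. r / 2 \<le> norm y \<and> norm y < 2 * r} y * g1 y)"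
          proof (cases "y \<in> ball y1 d")
            case True
            have n: "norm y > 1" "r / 2 \<le> norm y" "norm y < 2 * r" using ball[OF True] ball1[OF True] by auto
            have "norm y ^ (2 * m - 2) * g1 y \<le> (2 * r) ^ (2 * m - 2) * g1 y"
              using n g10[OF n(1)] by (intro mult_right_mono power_mono) auto
            moreover have "norm y ^ (2 * m - 2) * g1 y = g y" using n(1) by (auto simp: g1_def)
            ultimately show ?thesis using True n by simp
          next
            case False
            then show ?thesis using g10[of y] r(2) by (auto simp: indicator_def)
          qed
        qed auto
        also have "\<dots> = (2 * r) ^ (2 * m - 2) * (\<integral>y. indicator {y. r / 2 \<le> norm y \<and> norm y < 2 * r} y * g1 y \<partial>lborel)"
          by (rule integral_mult_right_zero)
        also have "\<dots> \<le> (2 * r) ^ (2 * m - 2) * e"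
          using r by (intro mult_left_mono s1(2)) auto
        finally have I: "(\<integral>y. indicator (ball y1 d) y * g y \<partial>lborel) \<le> (2 * r) ^ (2 * m - 2) * e" .
        have "2 * (ln r + s * ln (1 + X)) * (\<integral>y. indicator (ball y1 d) y * g y \<partial>lborel)
           \<le> 2 * (ln r + s * ln (1 + X)) * ((2 * r) ^ (2 * m - 2) * e)"
          using r(2) s0 lX by (intro mult_left_mono I) auto
        also have "\<dots> = b * Q * (ln r + s * ln (1 + X))"
        proof -
          have "2 * m - 1 = Suc (2 * m - 2)" using m2 by simp
          then have "2 * 2 ^ (2 * m - 2) * e = b" by (simp add: e_def)
          then show ?thesis by (auto simp: Q_def power_mult_distrib algebra_simps)
        qed
        also have "\<dots> \<le> b * Q * (L + s * ln (1 + X))" using b0 Q1 Lr by (intro mult_left_mono) auto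
        finally show ?thesis unfolding lneq .
      qed
      \<comment> \<open>The choice of \<rho> reduces this term to the constant \<open>M\<close>,
        which is small against \<open>\<delta> * L \<le> V y0 \<le> X\<close>.\<close>
      have t3: "4 * unit_ball_vol (2 * real m) * \<rho> ^ (2 * m) * \<Gamma> \<le> c / 4 * X"
      proof -
        have "((1 + X) powr (- s)) ^ (2 * m) = (1 + X) powr (- \<sigma>)"
          using X0 m2 by (simp add: powr_realpow[symmetric] powr_powr s_def)
        then have rn: "\<rho> ^ (2 * m) = (d / r) ^ (2 * m) * (1 + X) powr (- \<sigma>)"
          by (simp add: \<rho>_def power_mult_distrib power_divide)
        have dr: "(d / r) ^ (2 * m) \<le> 1" using d r(2) by (intro power_le_one) auto
        have "1 + 2 ^ (2 * m) * X \<le> 2 ^ (2 * m) * (1 + X)" by (simp add: distrib_left)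
        then have "(1 + 2 ^ (2 * m) * X) powr \<sigma> \<le> (2 ^ (2 * m) * (1 + X)) powr \<sigma>"
          using X0 sigma_pos by (intro powr_mono2) auto
        also have "\<dots> = (2 ^ (2 * m)) powr \<sigma> * (1 + X) powr \<sigma>" using X0 by (intro powr_mult)
        finally have "\<Gamma> \<le> K * ((2 ^ (2 * m)) powr \<sigma> * (1 + X) powr \<sigma>)" unfolding \<Gamma>_def using K(1) by (intro mult_left_mono) auto
        then have "\<rho> ^ (2 * m) * \<Gamma> \<le> (1 * (1 + X) powr (- \<sigma>)) * (K * ((2 ^ (2 * m)) powr \<sigma> * (1 + X) powr \<sigma>))"
          unfolding rn using dr K(1) by (intro mult_mono) (auto simp: \<Gamma>_def)
        also have "\<dots> = K * (2 ^ (2 * m)) powr \<sigma> * ((1 + X) powr (- \<sigma>) * (1 + X) powr \<sigma>)" by simp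
        also have "(1 + X) powr (- \<sigma>) * (1 + X) powr \<sigma> = 1" using X0 by (simp add: powr_add[symmetric])
        finally have "4 * unit_ball_vol (2 * real m) * (\<rho> ^ (2 * m) * \<Gamma>) \<le> M"
          unfolding M_def by (intro mult_left_mono) auto
        also have "M \<le> c / 4 * (\<delta> * L)" using LAM A0 by simp
        also have "\<dots> \<le> c / 4 * X" using V0L XV0 cC(1) by (intro mult_left_mono) auto
        finally show ?thesis by (simp add: mult.assoc)
      qed
      \<comment> \<open>The factor 5 inside \<open>L\<close> absorbs the 2 from
        \<open>1 + Q \<le> 2 * Q\<close>.\<close>
      have lnQ: "ln (1 + Q) \<le> p * L"
      proof -
        have "1 + Q \<le> 2 * Q" using Q1 by simp
        also have "\<dots> \<le> 5 ^ (2 * m - 2) * Q"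
        proof (rule mult_right_mono)
          have "(5::real) ^ 1 \<le> 5 ^ (2 * m - 2)" using m2 by (intro power_increasing) auto
          then show "(2::real) \<le> 5 ^ (2 * m - 2)" by simp
        qed (use Q1 in simp)
        also have "\<dots> = (5 * r) ^ (2 * m - 2)" by (simp add: Q_def power_mult_distrib)
        finally have "ln (1 + Q) \<le> ln ((5 * r) ^ (2 * m - 2))" using Q1 by (intro ln_mono) auto
        also have "\<dots> = p * L" unfolding p_def L_def by (rule ln_realpow)
        finally show ?thesis .
      qed
      \<comment> \<open>A quarter of \<open>c * X\<close> is spent on each of \<open>t1\<close> and
        \<open>t3\<close>; half is left for the logarithmic term.\<close>
      have "c / 2 * X \<le> b * Q * (L + s * ln (1 + X))" using est t1 t2 t3 by linarith
      then have "X \<le> \<delta> * Q * L"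
        by (rule log_absorption[OF less_imp_le[OF X0] Q1 cC(1) less_imp_le[OF b0] less_imp_le[OF s0] _ lnQ bs bp less_imp_le[OF Lr(2)]])
      then show False using XV0 V0 by linarith
    qed
    then show ?thesis unfolding eventually_at_infinity by blast
  qed
  show ?thesis
  proof (rule landau_o.smallI)
    fix \<delta> :: real assume "\<delta> > 0"
    have "eventually (\<lambda>y::real^'n. norm y > 1) at_infinity"
      unfolding eventually_at_infinity by (intro exI[of _ 2]) auto
    with key[OF \<open>\<delta> > 0\<close>]
    show "eventually (\<lambda>y. norm (v y) \<le> \<delta> * norm (norm y ^ (2 * m - 2) * ln (5 * norm y))) at_infinity"
    proof eventually_elim
      case (elim y)
      then show ?case using V(2,4)[of y] by (simp add: abs_mult)
    qed
  qed
qed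

end
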